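(* Let $R$ be a commutative ring. For any integers $m,n\geq 1$ and any $m$-brace $\mu$ in an $R$-algebra $A$, there is a unique $m$-brace $\mu_n$ in the algebra $A_n^t$ such that $$\mu_n(\mathrm{tr}(x_1),\ldots,\mathrm{tr}(x_m))=\mathrm{tr}(\mu(x_1,\ldots,x_m))\quad\text{for all } x_1,\ldots,x_m\in\check A.$$ If $\mu$ is cyclically symmetric, then so is $\mu_n$. If $m=2$ and $\mu$ is skew-symmetric, then $\mu_n$ is skew-symmetric.
   Context: Modules are $R$-modules; algebras are associative unital $R$-algebras. For a module $M$ and $m\ge 1$, an $m$-bracket in $M$ is a map $M^m\to M$ linear in all $m$ variables. It is cyclically symmetric if $\mu(x_1,\ldots,x_{m-1},x_m)=\mu(x_m,x_1,\ldots,x_{m-1})$ for all $x_i$; a 2-bracket is skew-symmetric if $\mu(x_1,x_2)=-\mu(x_2,x_1)$ for all $x_1,x_2$. Braces. For an algebra $A$, let $A'\subset A$ be the submodule spanned by all commutators $xy-yx$ and set $\check A=A/A'$ (so $\check A=A$ if $A$ is commutative). A derivation of $A$ is a linear map $d:A\to A$ with $d(xy)=d(x)y+xd(y)$; it carries $A'$ into itself and so induces a linear endomorphism of $\check A$. A weak derivation is a linear endomorphism of $\check A$ induced by a derivation of $A$. An $m$-brace in $A$ is an $m$-bracket in $\check A$ which is a weak derivation in each of its $m$ variables. In particular an $m$-brace in a commutative algebra $B$ is an $m$-bracket $B^m\to B$ that is a derivation in each variable. Trace algebras. For an algebra $A$ and $n\ge1$, $A_n$ is the commutative algebra generated over $R$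 by symbols $x_{ij}$ ($x\in A$, $i,j\in\{1,\ldots,n\}$) subject to the relations $1_{ij}=\delta_{ij}$, $(rx)_{ij}=r\,x_{ij}$, $(x+y)_{ij}=x_{ij}+y_{ij}$, $(xy)_{ij}=\sum_{l=1}^n x_{il}y_{lj}$ for all $x,y\in A$, $r\in R$ and all $i,j$. The trace is the linear map $\mathrm{tr}:A\to A_n$, $x\mapsto\sum_{i=1}^n x_{ii}$; it annihilates $A'$ and induces a linear map $\check A\to A_n$, also denoted $\mathrm{tr}$. The $n$-th trace algebra $A_n^t$ is the subalgebra of $A_n$ generated by $\mathrm{tr}(A)$. *)

theory Defs
  imports "HOL-Algebra.Module" "HOL-Algebra.QuotRing" "HOL-Algebra.Subrings" "HOL-Library.FuncSet"
begin

section \<open>Algebras, derivations and brackets\<close>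

text \<open>The library locale \<^locale>\<open>algebra\<close> is restricted to commutative algebras.\<close>

locale assoc_algebra = module + ring M +
  assumes smult_assoc2:
      "\<lbrakk>a \<in> carrier R; x \<in> carrier M; y \<in> carrier M\<rbrakk> \<Longrightarrow>
        (a \<odot>\<^bsub>M\<^esub> x) \<otimes>\<^bsub>M\<^esub> y = a \<odot>\<^bsub>M\<^esub> (x \<otimes>\<^bsub>M\<^esub> y)"
    and smult_assoc3:
      "\<lbrakk>a \<in> carrier R; x \<in> carrier M; y \<in> carrier M\<rbrakk> \<Longrightarrow>
        x \<otimes>\<^bsub>M\<^esub> (a \<odot>\<^bsub>M\<^esub> y) = a \<odot>\<^bsub>M\<^esub> (x \<otimes>\<^bsub>M\<^esub> y)"

definition linear_maps ::
    "('r, 'p) ring_scheme \<Rightarrow> ('r, 'a, 'q) module_scheme \<Rightarrow> ('r, 'b, 's) module_scheme \<Rightarrow> ('a \<Rightarrow> 'b) set"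
  where "linear_maps R M N = {f \<in> carrier M \<rightarrow> carrier N.
    (\<forall>x\<in>carrier M. \<forall>y\<in>carrier M. f (x \<oplus>\<^bsub>M\<^esub> y) = f x \<oplus>\<^bsub>N\<^esub> f y) \<and>
    (\<forall>r\<in>carrier R. \<forall>x\<in>carrier M. f (r \<odot>\<^bsub>M\<^esub> x) = r \<odot>\<^bsub>N\<^esub> f x)}"

definition derivations ::
    "('r, 'p) ring_scheme \<Rightarrow> ('r, 'a, 'q) module_scheme \<Rightarrow> ('a \<Rightarrow> 'a) set"
  where "derivations R A = {d \<in> linear_maps R A A.
    \<forall>x\<in>carrier A. \<forall>y\<in>carrier A. d (x \<otimes>\<^bsub>A\<^esub> y) = d x \<otimes>\<^bsub>A\<^esub> y \<oplus>\<^bsub>A\<^esub> x \<otimes>\<^bsub>A\<^esub> d y}"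

text \<open>Elements of \<open>M\<^sup>m\<close> are lists of length \<open>m\<close>; \<open>xs[i := x]\<close> varies the entry in position \<open>i\<close>
  (positions are counted from 0).  A map on \<open>M\<^sup>m\<close> takes the value \<^const>\<open>undefined\<close> elsewhere, so
  that equality of such maps is equality on \<open>M\<^sup>m\<close>.\<close>

definition tuples :: "('a, 'p) partial_object_scheme \<Rightarrow> nat \<Rightarrow> 'a list set"
  where "tuples M m = {xs. set xs \<subseteq> carrier M \<and> length xs = m}"

definition brackets ::
    "('r, 'p) ring_scheme \<Rightarrow> ('r, 'a, 'q) module_scheme \<Rightarrow> nat \<Rightarrow> ('a list \<Rightarrow> 'a) set"
  where "brackets R M m = {\<mu> \<in> tuples M m \<rightarrow>\<^sub>E carrier M.
    \<forall>xs\<in>tuples M m. \<forall>i<m. (\<lambda>x. \<mu> (xs[i := x])) \<in> linear_maps R M M}"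

definition cyclically_symmetric ::
    "('a, 'p) partial_object_scheme \<Rightarrow> nat \<Rightarrow> ('a list \<Rightarrow> 'a) \<Rightarrow> bool"
  where "cyclically_symmetric M m \<mu> \<longleftrightarrow>
    (\<forall>xs\<in>tuples M (m - 1). \<forall>x\<in>carrier M. \<mu> (xs @ [x]) = \<mu> (x # xs))"

definition skew_symmetric :: "('a, 'p) ring_scheme \<Rightarrow> ('a list \<Rightarrow> 'a) \<Rightarrow> bool"
  where "skew_symmetric M \<mu> \<longleftrightarrow>
    (\<forall>x\<in>carrier M. \<forall>y\<in>carrier M. \<mu> [x, y] = \<ominus>\<^bsub>M\<^esub> \<mu> [y, x])"


section \<open>Braces\<close>

definition commutator_submodule ::
    "('r, 'p) ring_scheme \<Rightarrow> ('r, 'a, 'q) module_scheme \<Rightarrow> 'a set"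
  where "commutator_submodule R A = (\<lambda>H. submodule H R A) hull
    {x \<otimes>\<^bsub>A\<^esub> y \<ominus>\<^bsub>A\<^esub> y \<otimes>\<^bsub>A\<^esub> x | x y. x \<in> carrier A \<and> y \<in> carrier A}"

text \<open>\<open>A/A'\<close> is only a module: the fields \<open>mult\<close> and \<open>one\<close> of the record are irrelevant.\<close>

definition check_module ::
    "('r, 'p) ring_scheme \<Rightarrow> ('r, 'a, 'q) module_scheme \<Rightarrow> ('r, 'a set) module"
  where "check_module R A = (let A' = commutator_submodule R A in
    \<lparr>carrier = a_rcosets\<^bsub>A\<^esub> A', mult = undefined, one = undefined,
     zero = A', add = set_add A,
     smult = (\<lambda>r C. \<Union>x\<in>C. A' +>\<^bsub>A\<^esub> (r \<odot>\<^bsub>A\<^esub> x))\<rparr>)"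

definition weak_derivations ::
    "('r, 'p) ring_scheme \<Rightarrow> ('r, 'a, 'q) module_scheme \<Rightarrow> ('a set \<Rightarrow> 'a set) set"
  where "weak_derivations R A = {f \<in> linear_maps R (check_module R A) (check_module R A).
    \<exists>d\<in>derivations R A. \<forall>x\<in>carrier A.
      f (commutator_submodule R A +>\<^bsub>A\<^esub> x) = commutator_submodule R A +>\<^bsub>A\<^esub> d x}"

definition braces ::
    "('r, 'p) ring_scheme \<Rightarrow> ('r, 'a, 'q) module_scheme \<Rightarrow> nat \<Rightarrow> ('a set list \<Rightarrow> 'a set) set"
  where "braces R A m = {\<mu> \<in> brackets R (check_module R A) m.
    \<forall>xs\<in>tuples (check_module R A) m. \<forall>i<m. (\<lambda>x. \<mu> (xs[i := x])) \<in> weak_derivations R A}"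

text \<open>For a commutative algebra \<open>B\<close> one has \<open>B' = 0\<close> and identifies \<open>B/B'\<close>, whose elements are
  the singletons \<open>{b}\<close>, with \<open>B\<close>.  Under this identification the braces in \<open>B\<close> are the following
  maps; see lemma \<open>bij_comm_braces_braces\<close>.\<close>

definition comm_braces ::
    "('r, 'p) ring_scheme \<Rightarrow> ('r, 'b, 'q) module_scheme \<Rightarrow> nat \<Rightarrow> ('b list \<Rightarrow> 'b) set"
  where "comm_braces R B m = {\<mu> \<in> brackets R B m.
    \<forall>xs\<in>tuples B m. \<forall>i<m. (\<lambda>x. \<mu> (xs[i := x])) \<in> derivations R B}"

lemma
  assumes "algebra R B"
  shows commutator_submodule_commutative: "commutator_submodule R B = {\<zero>\<^bsub>B\<^esub>}"
    and carrier_check_commutative: "carrier (check_module R B) = (\<lambda>x. {x}) ` carrier B"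
    and coset_commutative: "x \<in> carrier B \<Longrightarrow> commutator_submodule R B +>\<^bsub>B\<^esub> x = {x}"
    and add_check_commutative: "\<lbrakk>x \<in> carrier B; y \<in> carrier B\<rbrakk> \<Longrightarrow>
      {x} \<oplus>\<^bsub>check_module R B\<^esub> {y} = {x \<oplus>\<^bsub>B\<^esub> y}"
    and smult_check_commutative: "\<lbrakk>r \<in> carrier R; x \<in> carrier B\<rbrakk> \<Longrightarrow>
      r \<odot>\<^bsub>check_module R B\<^esub> {x} = {r \<odot>\<^bsub>B\<^esub> x}"
proof -
  interpret algebra R B by fact
  have zero: "submodule {\<zero>\<^bsub>B\<^esub>} R B"
    by (rule submoduleI) auto
  have comm: "{x \<otimes>\<^bsub>B\<^esub> y \<ominus>\<^bsub>B\<^esub> y \<otimes>\<^bsub>B\<^esub> x | x y. x \<in> carrier B \<and> y \<in> carrier B} \<subseteq> {\<zero>\<^bsub>B\<^esub>}"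
    by (auto simp: m_comm M.minus_eq M.r_neg)
  have "\<zero>\<^bsub>B\<^esub> \<in> H" if "submodule H R B" for H
    using subgroup.one_closed[OF submodule.axioms(1)[OF that]] by simp
  then show A': "commutator_submodule R B = {\<zero>\<^bsub>B\<^esub>}"
    using hull_minimal[OF comm, of "\<lambda>H. submodule H R B"] zero
    unfolding commutator_submodule_def hull_def by blast
  show "carrier (check_module R B) = (\<lambda>x. {x}) ` carrier B"
    unfolding check_module_def Let_def A' by (auto simp: A_RCOSETS_defs r_coset_def)
  show "x \<in> carrier B \<Longrightarrow> commutator_submodule R B +>\<^bsub>B\<^esub> x = {x}"
    unfolding A' by (simp add: a_r_coset_defs)
  show "\<lbrakk>x \<in> carrier B; y \<in> carrier B\<rbrakk> \<Longrightarrow> {x} \<oplus>\<^bsub>check_module R B\<^esub> {y} = {x \<oplus>\<^bsub>B\<^esub> y}"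
    by (simp add: check_module_def Let_def set_add_defs)
  show "\<lbrakk>r \<in> carrier R; x \<in> carrier B\<rbrakk> \<Longrightarrow> r \<odot>\<^bsub>check_module R B\<^esub> {x} = {r \<odot>\<^bsub>B\<^esub> x}"
    by (simp add: check_module_def Let_def A' a_r_coset_defs)
qed

lemma linear_maps_check_commutative:
  assumes B: "algebra R B" and fg: "\<And>x. x \<in> carrier B \<Longrightarrow> f {x} = {g x}"
  shows "f \<in> linear_maps R (check_module R B) (check_module R B) \<longleftrightarrow> g \<in> linear_maps R B B"
proof -
  interpret algebra R B by fact
  have "f \<in> carrier (check_module R B) \<rightarrow> carrier (check_module R B) \<longleftrightarrow> g \<in> carrier B \<rightarrow> carrier B"
    by (auto simp: carrier_check_commutative[OF B] fg Pi_iff)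
  then show ?thesis
    unfolding linear_maps_def
    by (auto simp: carrier_check_commutative[OF B] add_check_commutative[OF B]
        smult_check_commutative[OF B] fg Pi_iff)
qed

lemma weak_derivations_commutative:
  assumes B: "algebra R B" and fg: "\<And>x. x \<in> carrier B \<Longrightarrow> f {x} = {g x}"
  shows "f \<in> weak_derivations R B \<longleftrightarrow> g \<in> derivations R B"
proof -
  interpret algebra R B by fact
  have closed: "d \<in> derivations R B \<Longrightarrow> x \<in> carrier B \<Longrightarrow> d x \<in> carrier B" for d x
    by (auto simp: derivations_def linear_maps_def)
  have "g \<in> derivations R B"
    if d: "d \<in> derivations R B" and eq: "\<And>x. x \<in> carrier B \<Longrightarrow> {g x} = {d x}" for d
    using d eq by (auto simp: derivations_def linear_maps_def Pi_iff)
  then show ?thesis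
    using closed linear_maps_check_commutative[of R B f g, OF B fg]
    by (auto simp: weak_derivations_def coset_commutative[OF B] fg derivations_def)
qed

lemma bij_comm_braces_braces:
  assumes B: "algebra R B"
  shows "bij_betw (\<lambda>\<nu>. \<lambda>Xs\<in>tuples (check_module R B) m. {\<nu> (map the_elem Xs)})
    (comm_braces R B m) (braces R B m)"
proof -
  let ?C = "check_module R B" and ?s = "\<lambda>x. {x}"
  let ?\<Phi> = "\<lambda>\<nu>. \<lambda>Xs\<in>tuples ?C m. {\<nu> (map the_elem Xs)}"
  let ?\<Psi> = "\<lambda>\<mu>. \<lambda>xs\<in>tuples B m. the_elem (\<mu> (map ?s xs))"
  have the_s: "map the_elem (map ?s xs) = xs" for xs :: "'c list"
    by (simp add: comp_def)
  have tup: "tuples ?C m = map ?s ` tuples B m"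
  proof (intro equalityI subsetI)
    fix Xs assume Xs: "Xs \<in> tuples ?C m"
    then have "map ?s (map the_elem Xs) = Xs"
      by (auto simp: tuples_def carrier_check_commutative[OF B] intro!: map_idI)
    moreover have "map the_elem Xs \<in> tuples B m"
      using Xs by (auto simp: tuples_def carrier_check_commutative[OF B])
    ultimately show "Xs \<in> map ?s ` tuples B m" by (metis image_eqI)
  qed (auto simp: tuples_def carrier_check_commutative[OF B] intro!: imageI)
  have upd: "xs[i := x] \<in> tuples B m" if "xs \<in> tuples B m" "x \<in> carrier B" for xs i x
    using that set_update_subset_insert[of xs i x] by (auto simp: tuples_def)
  have key: "\<mu> \<in> braces R B m \<longleftrightarrow> \<nu> \<in> comm_braces R B m"
    if \<mu>: "\<mu> \<in> tuples ?C m \<rightarrow>\<^sub>E carrier ?C" and \<nu>: "\<nu> \<in> tuples B m \<rightarrow>\<^sub>E carrier B"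
      and eq: "\<And>xs. xs \<in> tuples B m \<Longrightarrow> \<mu> (map ?s xs) = {\<nu> xs}" for \<mu> \<nu>
  proof -
    have fg: "\<mu> ((map ?s xs)[i := {x}]) = {\<nu> (xs[i := x])}"
      if "xs \<in> tuples B m" "x \<in> carrier B" for xs i x
      using eq[OF upd[OF that]] by (simp add: map_update)
    have "(\<lambda>X. \<mu> ((map ?s xs)[i := X])) \<in> linear_maps R ?C ?C \<longleftrightarrow> (\<lambda>x. \<nu> (xs[i := x])) \<in> linear_maps R B B"
      "(\<lambda>X. \<mu> ((map ?s xs)[i := X])) \<in> weak_derivations R B \<longleftrightarrow> (\<lambda>x. \<nu> (xs[i := x])) \<in> derivations R B"
      if "xs \<in> tuples B m" for xs i
      by (rule linear_maps_check_commutative[OF B] weak_derivations_commutative[OF B], rule fg[OF that], assumption)+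
    then show ?thesis
      using \<mu> \<nu> by (simp add: braces_def comm_braces_def brackets_def tup)
  qed
  have sing: "{the_elem X} = X" if "X \<in> carrier ?C" for X
    using that by (auto simp: carrier_check_commutative[OF B])
  have the_closed: "the_elem X \<in> carrier B" if "X \<in> carrier ?C" for X
    using that by (auto simp: carrier_check_commutative[OF B])
  show ?thesis
  proof (rule bij_betw_byWitness[where f' = ?\<Psi>])
    show "\<forall>\<nu>\<in>comm_braces R B m. ?\<Psi> (?\<Phi> \<nu>) = \<nu>"
    proof
      fix \<nu> assume "\<nu> \<in> comm_braces R B m"
      then have "\<nu> \<in> extensional (tuples B m)"
        by (auto simp: comm_braces_def brackets_def PiE_def)
      then show "?\<Psi> (?\<Phi> \<nu>) = \<nu>"
        by (intro extensionalityI[of _ "tuples B m"]) (simp_all add: tup comp_def)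
    qed
    show "\<forall>\<mu>\<in>braces R B m. ?\<Phi> (?\<Psi> \<mu>) = \<mu>"
    proof
      fix \<mu> assume "\<mu> \<in> braces R B m"
      then have \<mu>: "\<mu> \<in> tuples ?C m \<rightarrow>\<^sub>E carrier ?C"
        by (simp add: braces_def brackets_def)
      then have "\<mu> (map ?s xs) \<in> carrier ?C" if "xs \<in> tuples B m" for xs
        using that by (auto simp: tup)
      with \<mu> show "?\<Phi> (?\<Psi> \<mu>) = \<mu>"
        by (intro extensionalityI[of _ "tuples ?C m"]) (auto simp: tup comp_def sing PiE_def del: equalityI)
    qed
    show "?\<Phi> ` comm_braces R B m \<subseteq> braces R B m"
    proof (rule image_subsetI)
      fix \<nu> assume \<nu>: "\<nu> \<in> comm_braces R B m"
      then have \<nu>': "\<nu> \<in> tuples B m \<rightarrow>\<^sub>E carrier B"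
        by (simp add: comm_braces_def brackets_def)
      have "?\<Phi> \<nu> \<in> tuples ?C m \<rightarrow>\<^sub>E carrier ?C"
        using \<nu>' by (auto simp: tup comp_def carrier_check_commutative[OF B])
      then show "?\<Phi> \<nu> \<in> braces R B m"
        using \<nu> by (subst key[OF _ \<nu>']) (auto simp: tup comp_def)
    qed
    show "?\<Psi> ` braces R B m \<subseteq> comm_braces R B m"
    proof (rule image_subsetI)
      fix \<mu> assume \<mu>: "\<mu> \<in> braces R B m"
      then have \<mu>': "\<mu> \<in> tuples ?C m \<rightarrow>\<^sub>E carrier ?C"
        by (simp add: braces_def brackets_def)
      then have closed: "\<mu> (map ?s xs) \<in> carrier ?C" if "xs \<in> tuples B m" for xs
        using that by (auto simp: tup)
      then have "?\<Psi> \<mu> \<in> tuples B m \<rightarrow>\<^sub>E carrier B"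
        by (auto intro: the_closed)
      then show "?\<Psi> \<mu> \<in> comm_braces R B m"
        using \<mu> closed by (subst key[OF \<mu>', symmetric]) (auto simp: sing)
    qed
  qed
qed


section \<open>Trace algebras\<close>

text \<open>The commutative algebra \<open>A\<^sub>n\<close> is given by its presentation: terms built from the constants
  \<open>r \<in> R\<close> and the symbols \<open>x\<^sub>i\<^sub>j\<close> (\<open>Gen x i j\<close>, with \<open>1 \<le> i, j \<le> n\<close>), modulo the smallest
  congruence containing the axioms of commutative \<open>R\<close>-algebras and the defining relations.\<close>

datatype ('r, 'a) alg_term =
    Const 'r
  | Gen 'a nat nat
  | Neg "('r, 'a) alg_term"
  | Add "('r, 'a) alg_term" "('r, 'a) alg_term"
  | Mult "('r, 'a) alg_term" "('r, 'a) alg_term"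

inductive_set rep_terms ::
    "('r, 'p) ring_scheme \<Rightarrow> ('r, 'a, 'q) module_scheme \<Rightarrow> nat \<Rightarrow> ('r, 'a) alg_term set"
  for R :: "('r, 'p) ring_scheme" and A :: "('r, 'a, 'q) module_scheme" and n :: nat
  where
    Const: "r \<in> carrier R \<Longrightarrow> Const r \<in> rep_terms R A n"
  | Gen: "\<lbrakk>x \<in> carrier A; i \<in> {1..n}; j \<in> {1..n}\<rbrakk> \<Longrightarrow> Gen x i j \<in> rep_terms R A n"
  | Neg: "s \<in> rep_terms R A n \<Longrightarrow> Neg s \<in> rep_terms R A n"
  | Add: "\<lbrakk>s \<in> rep_terms R A n; t \<in> rep_terms R A n\<rbrakk> \<Longrightarrow> Add s t \<in> rep_terms R A n"
  | Mult: "\<lbrakk>s \<in> rep_terms R A n; t \<in> rep_terms R A n\<rbrakk> \<Longrightarrow> Mult s t \<in> rep_terms R A n"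

inductive_set rep_eq ::
    "('r, 'p) ring_scheme \<Rightarrow> ('r, 'a, 'q) module_scheme \<Rightarrow> nat \<Rightarrow> ('r, 'a) alg_term rel"
  for R :: "('r, 'p) ring_scheme" and A :: "('r, 'a, 'q) module_scheme" and n :: nat
  where
    \<comment> \<open>congruence\<close>
    Refl: "s \<in> rep_terms R A n \<Longrightarrow> (s, s) \<in> rep_eq R A n"
  | Sym: "(s, t) \<in> rep_eq R A n \<Longrightarrow> (t, s) \<in> rep_eq R A n"
  | Trans: "\<lbrakk>(s, t) \<in> rep_eq R A n; (t, u) \<in> rep_eq R A n\<rbrakk> \<Longrightarrow> (s, u) \<in> rep_eq R A n"
  | Neg_cong: "(s, s') \<in> rep_eq R A n \<Longrightarrow> (Neg s, Neg s') \<in> rep_eq R A n"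
  | Add_cong: "\<lbrakk>(s, s') \<in> rep_eq R A n; (t, t') \<in> rep_eq R A n\<rbrakk> \<Longrightarrow>
      (Add s t, Add s' t') \<in> rep_eq R A n"
  | Mult_cong: "\<lbrakk>(s, s') \<in> rep_eq R A n; (t, t') \<in> rep_eq R A n\<rbrakk> \<Longrightarrow>
      (Mult s t, Mult s' t') \<in> rep_eq R A n"
    \<comment> \<open>axioms of commutative rings\<close>
  | Add_assoc: "\<lbrakk>s \<in> rep_terms R A n; t \<in> rep_terms R A n; u \<in> rep_terms R A n\<rbrakk> \<Longrightarrow>
      (Add (Add s t) u, Add s (Add t u)) \<in> rep_eq R A n"
  | Add_commute: "\<lbrakk>s \<in> rep_terms R A n; t \<in> rep_terms R A n\<rbrakk> \<Longrightarrow>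
      (Add s t, Add t s) \<in> rep_eq R A n"
  | Add_zero: "s \<in> rep_terms R A n \<Longrightarrow> (Add (Const \<zero>\<^bsub>R\<^esub>) s, s) \<in> rep_eq R A n"
  | Add_Neg: "s \<in> rep_terms R A n \<Longrightarrow> (Add (Neg s) s, Const \<zero>\<^bsub>R\<^esub>) \<in> rep_eq R A n"
  | Mult_assoc: "\<lbrakk>s \<in> rep_terms R A n; t \<in> rep_terms R A n; u \<in> rep_terms R A n\<rbrakk> \<Longrightarrow>
      (Mult (Mult s t) u, Mult s (Mult t u)) \<in> rep_eq R A n"
  | Mult_commute: "\<lbrakk>s \<in> rep_terms R A n; t \<in> rep_terms R A n\<rbrakk> \<Longrightarrow>
      (Mult s t, Mult t s) \<in> rep_eq R A n"
  | Mult_one: "s \<in> rep_terms R A n \<Longrightarrow> (Mult (Const \<one>\<^bsub>R\<^esub>) s, s) \<in> rep_eq R A n"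
  | Mult_distrib: "\<lbrakk>s \<in> rep_terms R A n; t \<in> rep_terms R A n; u \<in> rep_terms R A n\<rbrakk> \<Longrightarrow>
      (Mult (Add s t) u, Add (Mult s u) (Mult t u)) \<in> rep_eq R A n"
    \<comment> \<open>\<^const>\<open>Const\<close> is the structure homomorphism of an \<open>R\<close>-algebra\<close>
  | Const_add: "\<lbrakk>r \<in> carrier R; r' \<in> carrier R\<rbrakk> \<Longrightarrow>
      (Const (r \<oplus>\<^bsub>R\<^esub> r'), Add (Const r) (Const r')) \<in> rep_eq R A n"
  | Const_mult: "\<lbrakk>r \<in> carrier R; r' \<in> carrier R\<rbrakk> \<Longrightarrow>
      (Const (r \<otimes>\<^bsub>R\<^esub> r'), Mult (Const r) (Const r')) \<in> rep_eq R A n"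
    \<comment> \<open>the defining relations of \<open>A\<^sub>n\<close>\<close>
  | Gen_one: "\<lbrakk>i \<in> {1..n}; j \<in> {1..n}\<rbrakk> \<Longrightarrow>
      (Gen \<one>\<^bsub>A\<^esub> i j, Const (if i = j then \<one>\<^bsub>R\<^esub> else \<zero>\<^bsub>R\<^esub>)) \<in> rep_eq R A n"
  | Gen_smult: "\<lbrakk>r \<in> carrier R; x \<in> carrier A; i \<in> {1..n}; j \<in> {1..n}\<rbrakk> \<Longrightarrow>
      (Gen (r \<odot>\<^bsub>A\<^esub> x) i j, Mult (Const r) (Gen x i j)) \<in> rep_eq R A n"
  | Gen_add: "\<lbrakk>x \<in> carrier A; y \<in> carrier A; i \<in> {1..n}; j \<in> {1..n}\<rbrakk> \<Longrightarrow>
      (Gen (x \<oplus>\<^bsub>A\<^esub> y) i j, Add (Gen x i j) (Gen y i j)) \<in> rep_eq R A n"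
  | Gen_mult: "\<lbrakk>x \<in> carrier A; y \<in> carrier A; i \<in> {1..n}; j \<in> {1..n}\<rbrakk> \<Longrightarrow>
      (Gen (x \<otimes>\<^bsub>A\<^esub> y) i j,
       foldr (\<lambda>l t. Add (Mult (Gen x i l) (Gen y l j)) t) [1..<Suc n] (Const \<zero>\<^bsub>R\<^esub>)) \<in> rep_eq R A n"

definition rep_algebra ::
    "('r, 'p) ring_scheme \<Rightarrow> ('r, 'a, 'q) module_scheme \<Rightarrow> nat \<Rightarrow> ('r, ('r, 'a) alg_term set) module"
  where "rep_algebra R A n =
    \<lparr>carrier = rep_terms R A n // rep_eq R A n,
     mult = (\<lambda>C D. \<Union>s\<in>C. \<Union>t\<in>D. rep_eq R A n `` {Mult s t}),
     one = rep_eq R A n `` {Const \<one>\<^bsub>R\<^esub>},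
     zero = rep_eq R A n `` {Const \<zero>\<^bsub>R\<^esub>},
     add = (\<lambda>C D. \<Union>s\<in>C. \<Union>t\<in>D. rep_eq R A n `` {Add s t}),
     smult = (\<lambda>r C. \<Union>s\<in>C. rep_eq R A n `` {Mult (Const r) s})\<rparr>"

definition rep_entry ::
    "('r, 'p) ring_scheme \<Rightarrow> ('r, 'a, 'q) module_scheme \<Rightarrow> nat \<Rightarrow> 'a \<Rightarrow> nat \<Rightarrow> nat \<Rightarrow> ('r, 'a) alg_term set"
  where "rep_entry R A n x i j = rep_eq R A n `` {Gen x i j}"

definition rep_trace ::
    "('r, 'p) ring_scheme \<Rightarrow> ('r, 'a, 'q) module_scheme \<Rightarrow> nat \<Rightarrow> 'a \<Rightarrow> ('r, 'a) alg_term set"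
  where "rep_trace R A n x = (\<Oplus>\<^bsub>rep_algebra R A n\<^esub>i\<in>{1..n}. rep_entry R A n x i i)"

text \<open>The map induced by the trace on \<open>A/A'\<close>: it sends a coset to the common trace of its
  elements.\<close>

definition check_trace ::
    "('r, 'p) ring_scheme \<Rightarrow> ('r, 'a, 'q) module_scheme \<Rightarrow> nat \<Rightarrow> 'a set \<Rightarrow> ('r, 'a) alg_term set"
  where "check_trace R A n C = the_elem (rep_trace R A n ` C)"

definition trace_algebra ::
    "('r, 'p) ring_scheme \<Rightarrow> ('r, 'a, 'q) module_scheme \<Rightarrow> nat \<Rightarrow> ('r, ('r, 'a) alg_term set) module"
  where "trace_algebra R A n = (rep_algebra R A n)
    \<lparr>carrier := (\<lambda>S. subring S (rep_algebra R A n) \<and> submodule S R (rep_algebra R A n))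
      hull (rep_trace R A n ` carrier A)\<rparr>"

end

theory Submission
  imports Defs
begin

text \<open>
  A derivation of an algebra is determined by its values on generators, so a bracket on the trace
  algebra \<open>B\<close> that is a derivation in each variable is determined by its values on traces.  For
  existence, the brace \<open>\<mu>\<close> gives the function \<open>tr (\<mu> xs)\<close> on tuples over \<open>A/A'\<close>, and its variables are
  extended from \<open>A/A'\<close> to \<open>B\<close> one at a time.  A single variable can be extended because a derivation
  \<open>d\<close> of \<open>A\<close> induces the derivation \<open>x\<^sub>i\<^sub>j \<mapsto> (d x)\<^sub>i\<^sub>j\<close> of \<open>A\<^sub>n\<close>, which sends \<open>tr x\<close> to \<open>tr (d x)\<close>.  After
  some variables have been replaced by elements of \<open>B\<close>, the dependence on any other variable is,
  by the Leibniz rule, a \<open>B\<close>-linear combination of functions of the form \<open>tr \<circ> d\<close>.  Such a combination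
  is again \<open>D \<circ> tr\<close> for a derivation \<open>D\<close> of \<open>B\<close>, so the process continues.  The symmetry
  statements need only be checked on traces, by the uniqueness principle.
\<close>

section \<open>Derivations\<close>

lemma derivationsD:
  assumes "d \<in> derivations R B"
  shows "x \<in> carrier B \<Longrightarrow> d x \<in> carrier B"
    and "\<lbrakk>x \<in> carrier B; y \<in> carrier B\<rbrakk> \<Longrightarrow> d (x \<oplus>\<^bsub>B\<^esub> y) = d x \<oplus>\<^bsub>B\<^esub> d y"
    and "\<lbrakk>r \<in> carrier R; x \<in> carrier B\<rbrakk> \<Longrightarrow> d (r \<odot>\<^bsub>B\<^esub> x) = r \<odot>\<^bsub>B\<^esub> d x"
    and "\<lbrakk>x \<in> carrier B; y \<in> carrier B\<rbrakk> \<Longrightarrow> d (x \<otimes>\<^bsub>B\<^esub> y) = d x \<otimes>\<^bsub>B\<^esub> y \<oplus>\<^bsub>B\<^esub> x \<otimes>\<^bsub>B\<^esub> d y"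
  using assms by (auto simp: derivations_def linear_maps_def)

lemma derivationsI:
  assumes "\<And>x. x \<in> carrier B \<Longrightarrow> d x \<in> carrier B"
    and "\<And>x y. \<lbrakk>x \<in> carrier B; y \<in> carrier B\<rbrakk> \<Longrightarrow> d (x \<oplus>\<^bsub>B\<^esub> y) = d x \<oplus>\<^bsub>B\<^esub> d y"
    and "\<And>r x. \<lbrakk>r \<in> carrier R; x \<in> carrier B\<rbrakk> \<Longrightarrow> d (r \<odot>\<^bsub>B\<^esub> x) = r \<odot>\<^bsub>B\<^esub> d x"
    and "\<And>x y. \<lbrakk>x \<in> carrier B; y \<in> carrier B\<rbrakk> \<Longrightarrow> d (x \<otimes>\<^bsub>B\<^esub> y) = d x \<otimes>\<^bsub>B\<^esub> y \<oplus>\<^bsub>B\<^esub> x \<otimes>\<^bsub>B\<^esub> d y"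
  shows "d \<in> derivations R B"
  using assms by (auto simp: derivations_def linear_maps_def)

lemma tuples_update:
  "\<lbrakk>xs \<in> tuples M m; x \<in> carrier M\<rbrakk> \<Longrightarrow> xs[i := x] \<in> tuples M m"
  using set_update_subset_insert[of xs i x] by (auto simp: tuples_def)

lemma derivation_one:
  fixes B (structure)
  assumes "ring B" and d: "d \<in> derivations R B"
  shows "d \<one> = \<zero>"
proof -
  interpret ring B by fact
  have "d \<one> \<in> carrier B" "d \<one> = d \<one> \<oplus> d \<one>"
    using derivationsD(1,4)[OF d, of \<one>] derivationsD(4)[OF d, of \<one> \<one>] by simp_all
  then show ?thesis
    by (metis add.l_cancel_one')
qed

section \<open>Derivations of a commutative algebra as a module over it\<close>

context algebra
begin

text \<open>Maps are total functions, but only their values on the carrier matter for being a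
  derivation. Maps obtained by different constructions can thus be exchanged.\<close>

lemma derivation_cong:
  assumes d: "d \<in> derivations R M" and eq: "\<And>x. x \<in> carrier M \<Longrightarrow> d x = d' x"
  shows "d' \<in> derivations R M"
  using derivationsD[OF d]
  by (intro derivationsI) (simp_all add: eq[symmetric])

lemma smult_assoc3:
  "\<lbrakk>a \<in> carrier R; x \<in> carrier M; y \<in> carrier M\<rbrakk> \<Longrightarrow> x \<otimes>\<^bsub>M\<^esub> (a \<odot>\<^bsub>M\<^esub> y) = a \<odot>\<^bsub>M\<^esub> (x \<otimes>\<^bsub>M\<^esub> y)"
  using smult_assoc2[of a y x] by (simp add: m_comm)

lemma derivation_zero: "(\<lambda>_. \<zero>\<^bsub>M\<^esub>) \<in> derivations R M"
  by (rule derivationsI) simp_all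

text \<open>A multiple of a derivation still obeys the Leibniz rule because the coefficient commutes
  with the arguments. Sum and multiple are merged into one formula, so that a single closure rule
  serves the sum, product and scalar cases of later inductions.\<close>

lemma derivation_combination:
  assumes a: "a \<in> carrier M" and b: "b \<in> carrier M"
    and d: "d \<in> derivations R M" and e: "e \<in> derivations R M"
  shows "(\<lambda>x. a \<otimes>\<^bsub>M\<^esub> d x \<oplus>\<^bsub>M\<^esub> b \<otimes>\<^bsub>M\<^esub> e x) \<in> derivations R M"
  using a b derivationsD[OF d] derivationsD[OF e]
  by (intro derivationsI)
    (simp_all add: smult_assoc2 smult_assoc3 smult_r_distr r_distr l_distr M.a_ac m_ac)

lemma derivation_uminus:
  assumes d: "d \<in> derivations R M"
  shows "(\<lambda>x. \<ominus>\<^bsub>M\<^esub> d x) \<in> derivations R M"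
  using derivationsD[OF d]
  by (intro derivationsI) (simp_all add: M.minus_add l_minus r_minus smult_r_minus M.a_ac)

end

section \<open>Multiderivations of a generated algebra\<close>

text \<open>Generation by the elements \<open>t x\<close> is expressed as an induction principle;
  zero and negatives come from the scalars 0 and -1. The index set \<open>X\<close> is kept apart
  from its image because \<open>t\<close> need not be injective: the functions to be extended live
  on \<open>X\<close>, and that they depend on \<open>t x\<close> only is part of what has to be
  proved.\<close>

locale generated_algebra = algebra R B
  for R :: "('r, 'p) ring_scheme" and B :: "('r, 'b, 'q) module_scheme" (structure) +
  fixes X :: "'x set" and t :: "'x \<Rightarrow> 'b"
  assumes t_closed: "x \<in> X \<Longrightarrow> t x \<in> carrier B"
    and generated_induct [consumes 1, case_names gen one add mult smult]:
      "\<lbrakk>b \<in> carrier B; \<And>x. x \<in> X \<Longrightarrow> P (t x); P \<one>;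
        \<And>a b. \<lbrakk>a \<in> carrier B; b \<in> carrier B; P a; P b\<rbrakk> \<Longrightarrow> P (a \<oplus> b);
        \<And>a b. \<lbrakk>a \<in> carrier B; b \<in> carrier B; P a; P b\<rbrakk> \<Longrightarrow> P (a \<otimes> b);
        \<And>r a. \<lbrakk>r \<in> carrier R; a \<in> carrier B; P a\<rbrakk> \<Longrightarrow> P (r \<odot> a)\<rbrakk> \<Longrightarrow> P b"
begin

text \<open>Agreement passes through sums, products and scalar multiples, and both derivations
  vanish at 1.\<close>

lemma derivation_eqI:
  assumes d: "d \<in> derivations R B" and e: "e \<in> derivations R B"
    and eq: "\<And>x. x \<in> X \<Longrightarrow> d (t x) = e (t x)" and b: "b \<in> carrier B"
  shows "d b = e b"
  using b
  by (induction rule: generated_induct)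
    (simp_all add: eq derivationsD[OF d] derivationsD[OF e] derivation_one[OF ring_axioms d] derivation_one[OF ring_axioms e])

text \<open>In particular, such an \<open>f\<close> is constant on the fibres of \<open>t\<close> in
  \<open>X\<close>.\<close>

definition extends :: "('x \<Rightarrow> 'b) \<Rightarrow> bool"
  where "extends f \<longleftrightarrow> (\<exists>d\<in>derivations R B. \<forall>x\<in>X. d (t x) = f x)"

lemma extends_combination:
  assumes "a \<in> carrier B" "b \<in> carrier B" "extends f" "extends g"
  shows "extends (\<lambda>x. a \<otimes> f x \<oplus> b \<otimes> g x)"
proof -
  obtain d e where "d \<in> derivations R B" "\<forall>x\<in>X. d (t x) = f x"
    "e \<in> derivations R B" "\<forall>x\<in>X. e (t x) = g x"
    using assms unfolding extends_def by blast
  with assms show ?thesis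
    unfolding extends_def
    by (intro bexI[of _ "\<lambda>x. a \<otimes> d x \<oplus> b \<otimes> e x"] derivation_combination) auto
qed

lemma extends_zero: "extends (\<lambda>_. \<zero>)"
  using derivation_zero by (auto simp: extends_def)

lemma extends_cong: "\<lbrakk>extends f; \<And>x. x \<in> X \<Longrightarrow> f x = g x\<rbrakk> \<Longrightarrow> extends g"
  by (auto simp: extends_def)

text \<open>By the Leibniz rule, a derivation \<open>g\<close> with values in functions takes values in the
  \<open>B\<close>-submodule spanned by its values on the generators.\<close>

lemma derivation_family_induct:
  assumes b: "b \<in> carrier B"
    and d: "\<And>c. c \<in> C \<Longrightarrow> (\<lambda>b. g b c) \<in> derivations R B"
    and gen: "\<And>x. x \<in> X \<Longrightarrow> Q (g (t x))"
    and zero: "Q (\<lambda>_. \<zero>)"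
    and comb: "\<And>a b f h. \<lbrakk>a \<in> carrier B; b \<in> carrier B; Q f; Q h\<rbrakk> \<Longrightarrow> Q (\<lambda>c. a \<otimes> f c \<oplus> b \<otimes> h c)"
    and cong: "\<And>f h. \<lbrakk>Q f; \<And>c. c \<in> C \<Longrightarrow> f c = h c\<rbrakk> \<Longrightarrow> Q h"
  shows "Q (g b)"
  using b
proof (induction rule: generated_induct)
  case (gen x)
  then show ?case by (rule assms(3))
next
  case one
  show ?case
    by (rule cong[OF zero]) (simp add: derivation_one[OF ring_axioms d])
next
  case (add a b)
  show ?case
    by (rule cong[OF comb[OF one_closed one_closed add.IH]])
      (use add.hyps derivationsD[OF d] in simp)
next
  case (mult a b)
  \<comment> \<open>By the Leibniz rule and commutativity, \<open>g a\<close> gets the coefficient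
    \<open>b\<close> and \<open>g b\<close> the coefficient \<open>a\<close>; hence the swapped
    \<open>mult.hyps(2,1)\<close>.\<close>
  show ?case
    by (rule cong[OF comb[OF mult.hyps(2,1) mult.IH]])
      (use mult.hyps derivationsD[OF d] in \<open>simp add: m_comm\<close>)
next
  case (smult r a)
  \<comment> \<open>A scalar of \<open>R\<close> acts as the coefficient
    \<open>r \<odot> \<one>\<close> from the algebra; the second summand gets coefficient
    zero.\<close>
  have r: "r \<odot> \<one> \<in> carrier B"
    using smult.hyps by simp
  show ?case
    by (rule cong[OF comb[OF r M.zero_closed smult.IH smult.IH]])
      (use smult.hyps derivationsD[OF d] in \<open>simp add: smult_assoc2\<close>)
qed

text \<open>With all other variables fixed, \<open>derivation_eqI\<close> reduces one variable to
  generators; this is repeated for each variable.\<close>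

lemma multiderivation_eqI:
  assumes \<nu>: "\<And>bs i. \<lbrakk>bs \<in> tuples B m; i < m\<rbrakk> \<Longrightarrow> (\<lambda>b. \<nu> (bs[i := b])) \<in> derivations R B"
    and \<nu>': "\<And>bs i. \<lbrakk>bs \<in> tuples B m; i < m\<rbrakk> \<Longrightarrow> (\<lambda>b. \<nu>' (bs[i := b])) \<in> derivations R B"
    and eq: "\<And>xs. \<lbrakk>set xs \<subseteq> X; length xs = m\<rbrakk> \<Longrightarrow> \<nu> (map t xs) = \<nu>' (map t xs)"
    and bs: "bs \<in> tuples B m"
  shows "\<nu> bs = \<nu>' bs"
proof -
  \<comment> \<open>Strengthened for induction: the entries before \<open>bs\<close> are already
    generators, and each step moves the first entry of \<open>bs\<close> into that prefix.\<close>
  have "\<nu> (map t xs @ bs) = \<nu>' (map t xs @ bs)"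
    if "set xs \<subseteq> X" "set bs \<subseteq> carrier B" "length xs + length bs = m" for xs bs
    using that
  proof (induction bs arbitrary: xs)
    case Nil
    then show ?case by (simp add: eq)
  next
    case (Cons b bs)
    let ?bs = "map t xs @ b # bs"
    have tup: "?bs \<in> tuples B m" and i: "length xs < m"
      using Cons.prems t_closed by (auto simp: tuples_def)
    have upd: "?bs[length xs := c] = map t xs @ c # bs" for c
      by (metis length_map list_update_length)
    show ?case
    proof (rule derivation_eqI[OF \<nu>[OF tup i, unfolded upd] \<nu>'[OF tup i, unfolded upd]])
      show "b \<in> carrier B" using Cons.prems by simp
      show "\<nu> (map t xs @ t x # bs) = \<nu>' (map t xs @ t x # bs)" if "x \<in> X" for x
        using Cons.IH[of "xs @ [x]"] Cons.prems that by simp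
    qed
  qed
  from this[of "[]"] bs show ?thesis by (simp add: tuples_def)
qed

text \<open>The last \<open>length bs\<close> variables of \<open>F\<close> are extended from \<open>X\<close> to \<open>B\<close>, one at a time and
  beginning with the last one.\<close>

primrec extension :: "('x list \<Rightarrow> 'b) \<Rightarrow> 'b list \<Rightarrow> 'x list \<Rightarrow> 'b"
  where
    "extension F [] xs = F xs"
  | "extension F (b # bs) xs =
      (SOME d. d \<in> derivations R B \<and> (\<forall>x\<in>X. d (t x) = extension F bs (xs @ [x]))) b"

context
  fixes F :: "'x list \<Rightarrow> 'b" and m :: nat
  assumes F: "\<And>xs i. \<lbrakk>set xs \<subseteq> X; length xs = m; i < m\<rbrakk> \<Longrightarrow> extends (\<lambda>x. F (xs[i := x]))"
begin

text \<open>\<open>SOME\<close> yields an actual extension only if one exists. Any choice serves,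
  since the arguments below use only these two properties.\<close>

lemma extension_Cons:
  assumes "extends (\<lambda>x. extension F bs (xs @ [x]))"
  shows "(\<lambda>b. extension F (b # bs) xs) \<in> derivations R B"
    and "x \<in> X \<Longrightarrow> extension F (t x # bs) xs = extension F bs (xs @ [x])"
proof -
  have "\<exists>d. d \<in> derivations R B \<and> (\<forall>x\<in>X. d (t x) = extension F bs (xs @ [x]))"
    using assms by (auto simp: extends_def)
  from someI_ex[OF this]
  show "(\<lambda>b. extension F (b # bs) xs) \<in> derivations R B"
    and "x \<in> X \<Longrightarrow> extension F (t x # bs) xs = extension F bs (xs @ [x])"
    by simp_all
qed

text \<open>Induction on the number of variables already extended, for both claims at once. The
  first claim, at the last position of the prefix, is what allows the next variable to be extended;
  the second says that the result is a derivation in every variable extended so far.\<close>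

lemma extension_derivation:
  assumes "length bs = n" "set xs \<subseteq> X" "set bs \<subseteq> carrier B" "length xs + n = m"
  shows "i < length xs \<Longrightarrow> extends (\<lambda>x. extension F bs (xs[i := x]))"
    and "i < n \<Longrightarrow> (\<lambda>c. extension F (bs[i := c]) xs) \<in> derivations R B"
  using assms
proof (induction n arbitrary: bs xs i)
  case 0
  {
    case 1
    then show ?case using F[of xs i] by simp
  next
    case 2
    then show ?case by simp
  }
next
  case (Suc n)
  \<comment> \<open>The induction hypothesis speaks of prefixes with all entries in
    \<open>X\<close>, so the position to be varied is filled with a dummy \<open>x0\<close>. If
    \<open>X\<close> is empty there is no dummy, but then the zero derivation extends every
    function.\<close>
  have last: "extends (\<lambda>x. extension F cs (ys @ [x]))"
    if "set ys \<subseteq> X" "length ys + Suc n = m" "length cs = n" "set cs \<subseteq> carrier B" for ys cs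
  proof (cases "X = {}")
    case True
    then show ?thesis
      by (intro extends_cong[OF extends_zero]) simp
  next
    case False
    then obtain x0 where "x0 \<in> X" by blast
    then show ?thesis
      using Suc.IH(1)[of "length ys" "ys @ [x0]" cs] that by simp
  qed
  {
    case 1
    then obtain b cs where bs: "bs = b # cs" "length cs = n" "b \<in> carrier B" "set cs \<subseteq> carrier B"
      by (cases bs) auto
    have xs: "set (xs[i := x]) \<subseteq> X" if "x \<in> X" for x
      using 1 that set_update_subset_insert[of xs i x] by auto
    \<comment> \<open>The term is a derivation in \<open>b\<close> with values in functions of
      \<open>x\<close>, so it is enough to treat \<open>b = t y\<close>. There it equals
      \<open>extension F cs\<close> with \<open>y\<close> appended to the prefix, and the induction
      hypothesis applies.\<close>
    show ?case
      unfolding bs(1)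
    proof (rule derivation_family_induct[OF bs(3), where C = X and g = "\<lambda>b x. extension F (b # cs) (xs[i := x])"])
      show "(\<lambda>b. extension F (b # cs) (xs[i := x])) \<in> derivations R B" if "x \<in> X" for x
        using 1 bs xs[OF that] by (intro extension_Cons(1) last) simp_all
      show "extends (\<lambda>x. extension F (t y # cs) (xs[i := x]))" if y: "y \<in> X" for y
      proof (rule extends_cong)
        show "extends (\<lambda>x. extension F cs ((xs @ [y])[i := x]))"
          using 1 bs y by (intro Suc.IH(1)) simp_all
        show "extension F cs ((xs @ [y])[i := x]) = extension F (t y # cs) (xs[i := x])" if "x \<in> X" for x
          using 1 bs xs[OF that] y
          by (subst extension_Cons(2)[OF last]) (simp_all add: list_update_append1)
      qed
      show "extends h" if "extends f" "\<And>x. x \<in> X \<Longrightarrow> f x = h x" for f h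
        using that by (rule extends_cong)
    qed (fact extends_zero extends_combination)+
  next
    case 2
    then obtain b cs where bs: "bs = b # cs" "length cs = n" "b \<in> carrier B" "set cs \<subseteq> carrier B"
      by (cases bs) auto
    show ?case
    \<comment> \<open>In the newest variable the map is a derivation by choice. For an older one the
      argument of the first claim is repeated, with functions on \<open>carrier B\<close> in place
      of functions on \<open>X\<close>.\<close>
    proof (cases i)
      case 0
      with 2 bs show ?thesis
        by (simp del: extension.simps) (intro extension_Cons(1) last, simp_all)
    next
      case (Suc k)
      have cs: "set (cs[k := c]) \<subseteq> carrier B" if "c \<in> carrier B" for c
        using bs that set_update_subset_insert[of cs k c] by auto
      have "(\<lambda>c. extension F (b # cs[k := c]) xs) \<in> derivations R B"
      proof (rule derivation_family_induct[OF bs(3), where C = "carrier B" and g = "\<lambda>b c. extension F (b # cs[k := c]) xs"])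
        show "(\<lambda>b. extension F (b # cs[k := c]) xs) \<in> derivations R B" if "c \<in> carrier B" for c
          using 2 bs cs[OF that] by (intro extension_Cons(1) last) simp_all
        show "(\<lambda>c. extension F (t y # cs[k := c]) xs) \<in> derivations R B" if y: "y \<in> X" for y
        proof (rule derivation_cong)
          show "(\<lambda>c. extension F (cs[k := c]) (xs @ [y])) \<in> derivations R B"
            using 2 bs y Suc by (intro Suc.IH(2)) simp_all
          show "extension F (cs[k := c]) (xs @ [y]) = extension F (t y # cs[k := c]) xs"
            if "c \<in> carrier B" for c
            using 2 bs cs[OF that] y by (subst extension_Cons(2)[OF last]) simp_all
        qed
        show "h \<in> derivations R B"
          if "f \<in> derivations R B" "\<And>c. c \<in> carrier B \<Longrightarrow> f c = h c" for f h
          using that by (rule derivation_cong)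
      qed (fact derivation_zero derivation_combination)+
      with bs Suc show ?thesis by simp
    qed
  }
qed

text \<open>Each argument \<open>t y\<close> of the extension turns back into an argument
  \<open>y\<close> of \<open>F\<close>, appended to the prefix, so the order of the variables is
  kept.\<close>

lemma extension_map:
  "\<lbrakk>set xs \<subseteq> X; set ys \<subseteq> X; length xs + length ys = m\<rbrakk> \<Longrightarrow>
    extension F (map t ys) xs = F (xs @ ys)"
proof (induction ys arbitrary: xs)
  case Nil
  then show ?case by simp
next
  case (Cons y ys)
  have "extends (\<lambda>x. extension F (map t ys) ((xs @ [y])[length xs := x]))"
    using Cons.prems t_closed by (intro extension_derivation(1)[OF refl]) auto
  then have "extension F (t y # map t ys) xs = extension F (map t ys) (xs @ [y])"
    using Cons.prems by (intro extension_Cons(2)) simp_all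
  with Cons show ?case by simp
qed

lemma ex_comm_brace_extension:
  assumes "m \<ge> 1"
  shows "\<exists>\<nu>\<in>comm_braces R B m. \<forall>xs. set xs \<subseteq> X \<and> length xs = m \<longrightarrow> \<nu> (map t xs) = F xs"
proof
  \<comment> \<open>Restriction to tuples makes the map extensional, as \<open>brackets\<close>
    requires.\<close>
  let ?\<nu> = "\<lambda>bs\<in>tuples B m. extension F bs []"
  have der: "(\<lambda>b. ?\<nu> (bs[i := b])) \<in> derivations R B" if bs: "bs \<in> tuples B m" and i: "i < m" for bs i
  proof (rule derivation_cong)
    show "(\<lambda>b. extension F (bs[i := b]) []) \<in> derivations R B"
      using bs i by (intro extension_derivation(2)[where n = m]) (auto simp: tuples_def)
  qed (simp add: tuples_update[OF bs])
  \<comment> \<open>Closure is read off from the derivation in position 0, evaluated at the entry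
    already there; \<open>m \<ge> 1\<close> provides this position.\<close>
  have "?\<nu> bs \<in> carrier B" if bs: "bs \<in> tuples B m" for bs
  proof -
    have "bs ! 0 \<in> carrier B"
      using bs assms nth_mem[of 0 bs] by (auto simp: tuples_def simp del: nth_mem)
    from derivationsD(1)[OF der[OF bs, of 0] this] assms show ?thesis by simp
  qed
  with der show "?\<nu> \<in> comm_braces R B m"
    by (auto simp: comm_braces_def brackets_def derivations_def)
  show "\<forall>xs. set xs \<subseteq> X \<and> length xs = m \<longrightarrow> ?\<nu> (map t xs) = F xs"
    using extension_map[of "[]"] t_closed by (auto simp: tuples_def)
qed

end

end

section \<open>Symmetry conditions tested on generators\<close>

text \<open>Varying one entry of a tuple varies one entry of its rotation, so a brace composed with
  \<open>rotate1\<close> is again a derivation in each variable.\<close>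

lemma rotate1_update:
  assumes "i < length xs"
  shows "rotate1 (xs[i := x]) = (rotate1 xs)[(if i = 0 then length xs - 1 else i - 1) := x]"
  using assms by (cases xs) (auto simp: list_update_append1 split: nat.split)

context generated_algebra
begin

lemma comm_braces_derivation:
  "\<lbrakk>\<nu> \<in> comm_braces R B m; bs \<in> tuples B m; i < m\<rbrakk> \<Longrightarrow> (\<lambda>b. \<nu> (bs[i := b])) \<in> derivations R B"
  by (simp add: comm_braces_def)

text \<open>Cyclic symmetry equates \<open>\<nu>\<close> with its composite with
  \<open>rotate1\<close>; \<open>multiderivation_eqI\<close> applies to these two maps.\<close>

lemma cyclically_symmetricI:
  assumes \<nu>: "\<nu> \<in> comm_braces R B m" and m: "m \<ge> 1"
    and eq: "\<And>x xs. \<lbrakk>x \<in> X; set xs \<subseteq> X; length xs = m - 1\<rbrakk> \<Longrightarrow>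
      \<nu> (map t (xs @ [x])) = \<nu> (map t (x # xs))"
  shows "cyclically_symmetric B m \<nu>"
proof -
  have "\<nu> (rotate1 bs) = \<nu> bs" if "bs \<in> tuples B m" for bs
  proof (rule multiderivation_eqI[where \<nu> = "\<lambda>bs. \<nu> (rotate1 bs)", OF _ comm_braces_derivation[OF \<nu>] _ that])
    fix bs i assume "bs \<in> tuples B m" "i < m"
    then show "(\<lambda>b. \<nu> (rotate1 (bs[i := b]))) \<in> derivations R B"
      using comm_braces_derivation[OF \<nu>, of "rotate1 bs"]
      by (simp add: rotate1_update tuples_def)
  next
    fix xs assume "set xs \<subseteq> X" "length xs = m"
    with m eq show "\<nu> (rotate1 (map t xs)) = \<nu> (map t xs)"
      by (cases xs) auto
  qed
  from this[of "x # xs" for x xs] m show ?thesis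
    by (auto simp: cyclically_symmetric_def tuples_def)
qed

text \<open>On pairs \<open>rev\<close> swaps the arguments, and the negative of a derivation is a
  derivation; so \<open>multiderivation_eqI\<close> applies again.\<close>

lemma skew_symmetricI:
  assumes \<nu>: "\<nu> \<in> comm_braces R B 2"
    and eq: "\<And>x y. \<lbrakk>x \<in> X; y \<in> X\<rbrakk> \<Longrightarrow> \<nu> [t x, t y] = \<ominus> \<nu> [t y, t x]"
  shows "skew_symmetric B \<nu>"
proof -
  have "\<nu> bs = \<ominus> \<nu> (rev bs)" if "bs \<in> tuples B 2" for bs
  proof (rule multiderivation_eqI[where \<nu>' = "\<lambda>bs. \<ominus> \<nu> (rev bs)", OF comm_braces_derivation[OF \<nu>] _ _ that])
    fix bs and i :: nat assume "bs \<in> tuples B 2" "i < 2"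
    then show "(\<lambda>b. \<ominus> \<nu> (rev (bs[i := b]))) \<in> derivations R B"
      using comm_braces_derivation[OF \<nu>, of "rev bs"]
      by (intro derivation_uminus) (simp add: rev_update tuples_def)
  next
    fix xs assume "set xs \<subseteq> X" "length xs = 2"
    then obtain x y where "xs = [x, y]" "x \<in> X" "y \<in> X"
      by (auto simp: numeral_2_eq_2 length_Suc_conv)
    with eq[of x y] show "\<nu> (map t xs) = \<ominus> \<nu> (rev (map t xs))"
      by simp
  qed
  note skew = this
  show ?thesis
    unfolding skew_symmetric_def
  proof (intro ballI)
    fix x y assume "x \<in> carrier B" "y \<in> carrier B"
    then have "[x, y] \<in> tuples B 2" by (simp add: tuples_def)
    from skew[OF this] show "\<nu> [x, y] = \<ominus> \<nu> [y, x]" by simp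
  qed
qed

end

section \<open>Finite sums\<close>

lemma (in abelian_monoid) finsum_swap:
  assumes "finite I" "finite J" "\<And>i j. \<lbrakk>i \<in> I; j \<in> J\<rbrakk> \<Longrightarrow> f i j \<in> carrier G"
  shows "(\<Oplus>i\<in>I. \<Oplus>j\<in>J. f i j) = (\<Oplus>j\<in>J. \<Oplus>i\<in>I. f i j)"
  using assms(1,3)
proof (induction rule: finite_induct)
  case empty
  then show ?case by simp
next
  case (insert k I)
  then have "(\<Oplus>j\<in>J. \<Oplus>i\<in>insert k I. f i j) = (\<Oplus>j\<in>J. f k j \<oplus> (\<Oplus>i\<in>I. f i j))"
    by (intro finsum_cong') (auto simp: Pi_iff)
  also have "\<dots> = (\<Oplus>j\<in>J. f k j) \<oplus> (\<Oplus>j\<in>J. \<Oplus>i\<in>I. f i j)"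
    using insert by (intro finsum_addf) auto
  finally show ?case
    using insert by (simp add: Pi_iff)
qed

lemma derivation_finsum:
  fixes B (structure)
  assumes "ring B" and d: "d \<in> derivations R B"
    and "finite I" and "\<And>i. i \<in> I \<Longrightarrow> f i \<in> carrier B"
  shows "d (\<Oplus>i\<in>I. f i) = (\<Oplus>i\<in>I. d (f i))"
  using assms(3,4)
proof (induction rule: finite_induct)
  interpret ring B by fact
  case empty
  have "d \<zero> \<in> carrier B" "d \<zero> = d \<zero> \<oplus> d \<zero>"
    using derivationsD(1)[OF d, of \<zero>] derivationsD(2)[OF d, of \<zero> \<zero>] by simp_all
  then have "d \<zero> = \<zero>" by (metis add.l_cancel_one')
  then show ?case by simp
next
  interpret ring B by fact
  case (insert i I)
  then show ?case using derivationsD(1,2)[OF d] by (simp add: Pi_iff)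
qed

section \<open>The algebra \<open>A\<^sub>n\<close> and its trace\<close>

locale representation_algebra = assoc_algebra R A
  for R :: "('r, 'p) ring_scheme" and A :: "('r, 'a, 'q) module_scheme" +
  fixes n :: nat
begin

abbreviation "T \<equiv> rep_terms R A n"
abbreviation "E \<equiv> rep_eq R A n"
abbreviation "An \<equiv> rep_algebra R A n"

definition cls :: "('r, 'a) alg_term \<Rightarrow> ('r, 'a) alg_term set"
  where "cls s = E `` {s}"

section \<open>Calculation with classes of terms\<close>

text \<open>An arbitrary list \<open>ls\<close> permits induction; the relation
  \<open>Gen_mult\<close> is the case \<open>[1..<Suc n]\<close>.\<close>

lemma foldr_terms:
  "\<lbrakk>x \<in> carrier A; y \<in> carrier A; i \<in> {1..n}; j \<in> {1..n}; set ls \<subseteq> {1..n}\<rbrakk> \<Longrightarrow>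
    foldr (\<lambda>l t. Add (Mult (Gen x i l) (Gen y l j)) t) ls (Const \<zero>\<^bsub>R\<^esub>) \<in> T"
  by (induction ls) (auto intro!: rep_terms.intros)

lemma rep_eq_terms: "(s, t) \<in> E \<Longrightarrow> s \<in> T \<and> t \<in> T"
proof (induction rule: rep_eq.induct)
  case (Gen_mult x y i j)
  then show ?case
    by (auto simp del: upt_Suc intro!: rep_terms.intros foldr_terms)
qed (auto intro!: rep_terms.intros)

lemma equiv_rep_eq: "equiv T E"
  by (intro equivI refl_onI symI transI)
    (auto intro: rep_eq.Refl rep_eq.Sym rep_eq.Trans dest: rep_eq_terms)

lemma cls_eqI: "(s, t) \<in> E \<Longrightarrow> cls s = cls t"
  unfolding cls_def by (rule equiv_class_eq[OF equiv_rep_eq])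

lemma cls_closed: "s \<in> T \<Longrightarrow> cls s \<in> carrier An"
  by (simp add: rep_algebra_def cls_def quotientI)

lemma carrier_cases:
  assumes "C \<in> carrier An"
  obtains s where "s \<in> T" "C = cls s"
  using assms by (auto simp: rep_algebra_def cls_def elim: quotientE)

text \<open>The unions in \<open>rep_algebra\<close> collapse to one class because the congruence
  rules make the operation independent of representatives. The same holds for the next two
  operations.\<close>

lemma add_cls: "\<lbrakk>s \<in> T; t \<in> T\<rbrakk> \<Longrightarrow> cls s \<oplus>\<^bsub>An\<^esub> cls t = cls (Add s t)"
  unfolding rep_algebra_def cls_def
  by (simp, rule UN_equiv_class2[OF equiv_rep_eq equiv_rep_eq])
    (auto simp: congruent2_def intro!: equiv_class_eq[OF equiv_rep_eq] rep_eq.Add_cong)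

lemma mult_cls: "\<lbrakk>s \<in> T; t \<in> T\<rbrakk> \<Longrightarrow> cls s \<otimes>\<^bsub>An\<^esub> cls t = cls (Mult s t)"
  unfolding rep_algebra_def cls_def
  by (simp, rule UN_equiv_class2[OF equiv_rep_eq equiv_rep_eq])
    (auto simp: congruent2_def intro!: equiv_class_eq[OF equiv_rep_eq] rep_eq.Mult_cong)

lemma smult_cls: "\<lbrakk>r \<in> carrier R; s \<in> T\<rbrakk> \<Longrightarrow> r \<odot>\<^bsub>An\<^esub> cls s = cls (Mult (Const r) s)"
  unfolding rep_algebra_def cls_def
  by (simp, rule UN_equiv_class[OF equiv_rep_eq])
    (auto simp: congruent_def intro!: equiv_class_eq[OF equiv_rep_eq] rep_eq.Mult_cong rep_eq.Refl rep_terms.intros)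

lemma zero_cls: "\<zero>\<^bsub>An\<^esub> = cls (Const \<zero>\<^bsub>R\<^esub>)"
  and one_cls: "\<one>\<^bsub>An\<^esub> = cls (Const \<one>\<^bsub>R\<^esub>)"
  by (simp_all add: rep_algebra_def cls_def)

lemmas cls_ops = add_cls mult_cls smult_cls zero_cls one_cls

lemma cring_rep_algebra: "cring An"
proof -
  note [simp] = rep_terms.intros cls_closed cls_ops
  have ops_closed: "x \<oplus>\<^bsub>An\<^esub> y \<in> carrier An" "x \<otimes>\<^bsub>An\<^esub> y \<in> carrier An"
    and commute: "x \<oplus>\<^bsub>An\<^esub> y = y \<oplus>\<^bsub>An\<^esub> x" "x \<otimes>\<^bsub>An\<^esub> y = y \<otimes>\<^bsub>An\<^esub> x"
    if xy: "x \<in> carrier An" "y \<in> carrier An" for x y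
  proof -
    obtain s t where "s \<in> T" "x = cls s" "t \<in> T" "y = cls t"
      using xy by (metis carrier_cases)
    then show "x \<oplus>\<^bsub>An\<^esub> y \<in> carrier An" "x \<otimes>\<^bsub>An\<^esub> y \<in> carrier An"
      "x \<oplus>\<^bsub>An\<^esub> y = y \<oplus>\<^bsub>An\<^esub> x" "x \<otimes>\<^bsub>An\<^esub> y = y \<otimes>\<^bsub>An\<^esub> x"
      by (simp_all add: cls_eqI[OF rep_eq.Add_commute] cls_eqI[OF rep_eq.Mult_commute])
  qed
  have assoc: "x \<oplus>\<^bsub>An\<^esub> y \<oplus>\<^bsub>An\<^esub> z = x \<oplus>\<^bsub>An\<^esub> (y \<oplus>\<^bsub>An\<^esub> z)"
    "x \<otimes>\<^bsub>An\<^esub> y \<otimes>\<^bsub>An\<^esub> z = x \<otimes>\<^bsub>An\<^esub> (y \<otimes>\<^bsub>An\<^esub> z)"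
    and distrib: "(x \<oplus>\<^bsub>An\<^esub> y) \<otimes>\<^bsub>An\<^esub> z = x \<otimes>\<^bsub>An\<^esub> z \<oplus>\<^bsub>An\<^esub> y \<otimes>\<^bsub>An\<^esub> z"
    if xyz: "x \<in> carrier An" "y \<in> carrier An" "z \<in> carrier An" for x y z
  proof -
    obtain s t u where "s \<in> T" "x = cls s" "t \<in> T" "y = cls t" "u \<in> T" "z = cls u"
      using xyz by (metis carrier_cases)
    then show "x \<oplus>\<^bsub>An\<^esub> y \<oplus>\<^bsub>An\<^esub> z = x \<oplus>\<^bsub>An\<^esub> (y \<oplus>\<^bsub>An\<^esub> z)"
      "x \<otimes>\<^bsub>An\<^esub> y \<otimes>\<^bsub>An\<^esub> z = x \<otimes>\<^bsub>An\<^esub> (y \<otimes>\<^bsub>An\<^esub> z)"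
      "(x \<oplus>\<^bsub>An\<^esub> y) \<otimes>\<^bsub>An\<^esub> z = x \<otimes>\<^bsub>An\<^esub> z \<oplus>\<^bsub>An\<^esub> y \<otimes>\<^bsub>An\<^esub> z"
      by (simp_all add: cls_eqI[OF rep_eq.Add_assoc] cls_eqI[OF rep_eq.Mult_assoc] cls_eqI[OF rep_eq.Mult_distrib])
  qed
  have units: "\<zero>\<^bsub>An\<^esub> \<oplus>\<^bsub>An\<^esub> x = x" "\<one>\<^bsub>An\<^esub> \<otimes>\<^bsub>An\<^esub> x = x"
    and uminus: "\<exists>y\<in>carrier An. y \<oplus>\<^bsub>An\<^esub> x = \<zero>\<^bsub>An\<^esub>"
    if x: "x \<in> carrier An" for x
  proof -
    obtain s where s: "s \<in> T" "x = cls s"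
      using x by (metis carrier_cases)
    then show "\<zero>\<^bsub>An\<^esub> \<oplus>\<^bsub>An\<^esub> x = x" "\<one>\<^bsub>An\<^esub> \<otimes>\<^bsub>An\<^esub> x = x"
      by (simp_all add: cls_eqI[OF rep_eq.Add_zero] cls_eqI[OF rep_eq.Mult_one])
    show "\<exists>y\<in>carrier An. y \<oplus>\<^bsub>An\<^esub> x = \<zero>\<^bsub>An\<^esub>"
      using s by (intro bexI[of _ "cls (Neg s)"]) (simp_all add: cls_eqI[OF rep_eq.Add_Neg])
  qed
  have zero_one: "\<zero>\<^bsub>An\<^esub> \<in> carrier An" "\<one>\<^bsub>An\<^esub> \<in> carrier An"
    by simp_all
  show ?thesis
    by (intro cringI abelian_groupI comm_monoidI) (fact ops_closed commute assoc distrib units uminus zero_one)+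
qed

text \<open>The scalar \<open>r\<close> acts as multiplication by \<open>cls (Const r)\<close>, so
  the module axioms follow from the ring axioms and from \<open>Const\<close> inducing a ring
  homomorphism.\<close>

lemma algebra_rep_algebra: "algebra R An"
proof -
  note [simp] = rep_terms.intros cls_closed
  interpret An: cring An by (rule cring_rep_algebra)
  have smult: "r \<odot>\<^bsub>An\<^esub> x = cls (Const r) \<otimes>\<^bsub>An\<^esub> x" if "r \<in> carrier R" "x \<in> carrier An" for r x
  proof -
    from that(2) obtain s where "s \<in> T" "x = cls s" by (rule carrier_cases)
    with that(1) show ?thesis by (simp add: cls_ops)
  qed
  have Const: "cls (Const (r \<oplus>\<^bsub>R\<^esub> r')) = cls (Const r) \<oplus>\<^bsub>An\<^esub> cls (Const r')"
    "cls (Const (r \<otimes>\<^bsub>R\<^esub> r')) = cls (Const r) \<otimes>\<^bsub>An\<^esub> cls (Const r')"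
    if "r \<in> carrier R" "r' \<in> carrier R" for r r'
    using that by (auto simp: cls_ops intro!: cls_eqI rep_eq.Const_add rep_eq.Const_mult del: equalityI)
  show ?thesis
  proof (rule algebraI)
    show "\<one>\<^bsub>R\<^esub> \<odot>\<^bsub>An\<^esub> x = x" if "x \<in> carrier An" for x
      using that by (simp add: smult flip: one_cls)
  qed (simp_all add: R.is_cring An.is_cring smult Const An.l_distr An.r_distr An.m_assoc)
qed

sublocale An: algebra R An
  by (rule algebra_rep_algebra)

section \<open>Matrix entries in A_n\<close>

abbreviation "entry \<equiv> rep_entry R A n"

lemma cls_Gen: "cls (Gen x i j) = entry x i j"
  by (simp add: rep_entry_def cls_def)

lemma cls_Const:
  assumes "r \<in> carrier R" shows "cls (Const r) = r \<odot>\<^bsub>An\<^esub> \<one>\<^bsub>An\<^esub>"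
proof -
  have "(Mult (Const r) (Const \<one>\<^bsub>R\<^esub>), Const r) \<in> E"
    using assms by (intro rep_eq.Trans[OF rep_eq.Mult_commute rep_eq.Mult_one] rep_terms.Const) simp_all
  with assms show ?thesis
    by (simp add: one_cls smult_cls rep_terms.Const cls_eqI)
qed

context
  fixes i j assumes ij: "i \<in> {1..n}" "j \<in> {1..n}"
begin

lemma entry_closed: "x \<in> carrier A \<Longrightarrow> entry x i j \<in> carrier An"
  using ij by (auto simp flip: cls_Gen intro!: cls_closed rep_terms.intros)

lemma entry_smult:
  "\<lbrakk>r \<in> carrier R; x \<in> carrier A\<rbrakk> \<Longrightarrow> entry (r \<odot>\<^bsub>A\<^esub> x) i j = r \<odot>\<^bsub>An\<^esub> entry x i j"
  using cls_eqI[OF rep_eq.Gen_smult[OF _ _ ij]] ij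
  by (simp add: smult_cls rep_terms.intros flip: cls_Gen)

text \<open>No defining relation concerns the zero of \<open>A\<close>; its entries vanish because
  it is a multiple of itself by the scalar 0.\<close>

lemma entry_zero: "entry \<zero>\<^bsub>A\<^esub> i j = \<zero>\<^bsub>An\<^esub>"
  using entry_smult[of "\<zero>\<^bsub>R\<^esub>" "\<zero>\<^bsub>A\<^esub>"] by (simp add: entry_closed)

lemma entry_add:
  "\<lbrakk>x \<in> carrier A; y \<in> carrier A\<rbrakk> \<Longrightarrow> entry (x \<oplus>\<^bsub>A\<^esub> y) i j = entry x i j \<oplus>\<^bsub>An\<^esub> entry y i j"
  using cls_eqI[OF rep_eq.Gen_add[OF _ _ ij]] ij
  by (simp add: add_cls rep_terms.intros flip: cls_Gen)

end

lemma entry_mult: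
  assumes "x \<in> carrier A" "y \<in> carrier A" "i \<in> {1..n}" "j \<in> {1..n}"
  shows "entry (x \<otimes>\<^bsub>A\<^esub> y) i j = (\<Oplus>\<^bsub>An\<^esub>l\<in>{1..n}. entry x i l \<otimes>\<^bsub>An\<^esub> entry y l j)"
proof -
  \<comment> \<open>Distinctness of \<open>ls\<close> lets the sum along the list become a sum over
    the set of its entries.\<close>
  have "cls (foldr (\<lambda>l t. Add (Mult (Gen x i l) (Gen y l j)) t) ls (Const \<zero>\<^bsub>R\<^esub>)) =
      (\<Oplus>\<^bsub>An\<^esub>l\<in>set ls. entry x i l \<otimes>\<^bsub>An\<^esub> entry y l j)"
    if "set ls \<subseteq> {1..n}" "distinct ls" for ls
    using that
  proof (induction ls)
    case Nil
    then show ?case by (simp add: zero_cls)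
  next
    case (Cons l ls)
    have "cls (foldr (\<lambda>l t. Add (Mult (Gen x i l) (Gen y l j)) t) (l # ls) (Const \<zero>\<^bsub>R\<^esub>)) =
        entry x i l \<otimes>\<^bsub>An\<^esub> entry y l j \<oplus>\<^bsub>An\<^esub>
        cls (foldr (\<lambda>l t. Add (Mult (Gen x i l) (Gen y l j)) t) ls (Const \<zero>\<^bsub>R\<^esub>))"
      using Cons.prems assms
      by (simp add: add_cls mult_cls foldr_terms rep_terms.intros flip: cls_Gen)
    with Cons assms show ?case
      by (simp add: Pi_iff entry_closed subset_iff)
  qed
  from this[of "[1..<Suc n]"] have "cls (foldr (\<lambda>l t. Add (Mult (Gen x i l) (Gen y l j)) t)
      [1..<Suc n] (Const \<zero>\<^bsub>R\<^esub>)) = (\<Oplus>\<^bsub>An\<^esub>l\<in>{1..n}. entry x i l \<otimes>\<^bsub>An\<^esub> entry y l j)"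
    by (simp add: atLeastLessThanSuc_atLeastAtMost del: upt_Suc)
  with cls_eqI[OF rep_eq.Gen_mult[OF assms]] show ?thesis
    by (simp only: cls_Gen)
qed

section \<open>Derivations of A_n induced by derivations of A\<close>

text \<open>The values on compound terms are forced by linearity and the Leibniz rule. They lie in
  A_n rather than among the terms, so that they can be compared by the ring laws there.\<close>

primrec term_derivation :: "('a \<Rightarrow> 'a) \<Rightarrow> ('r, 'a) alg_term \<Rightarrow> ('r, 'a) alg_term set"
  where
    "term_derivation d (Const r) = \<zero>\<^bsub>An\<^esub>"
  | "term_derivation d (Gen x i j) = entry (d x) i j"
  | "term_derivation d (Neg s) = \<ominus>\<^bsub>An\<^esub> term_derivation d s"
  | "term_derivation d (Add s t) = term_derivation d s \<oplus>\<^bsub>An\<^esub> term_derivation d t"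
  | "term_derivation d (Mult s t) =
      term_derivation d s \<otimes>\<^bsub>An\<^esub> cls t \<oplus>\<^bsub>An\<^esub> cls s \<otimes>\<^bsub>An\<^esub> term_derivation d t"

context
  fixes d assumes d: "d \<in> derivations R A"
begin

lemma term_derivation_closed: "s \<in> T \<Longrightarrow> term_derivation d s \<in> carrier An"
  by (induction rule: rep_terms.induct)
    (simp_all add: entry_closed derivationsD[OF d] cls_closed)

text \<open>For the ring axioms this is a computation in A_n. \<open>Gen_one\<close>,
  \<open>Gen_smult\<close> and \<open>Gen_add\<close> are respected because \<open>d\<close> is
  linear and kills 1, and \<open>Gen_mult\<close> because of the Leibniz rule for
  \<open>d\<close>.\<close>

lemma term_derivation_cong: "(s, t) \<in> E \<Longrightarrow> term_derivation d s = term_derivation d t"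
proof (induction rule: rep_eq.induct)
  case (Mult_cong s s' t t')
  then show ?case by (simp add: cls_eqI[of s s'] cls_eqI[of t t'])
next
  case (Mult_assoc s t u)
  then show ?case
    by (simp add: term_derivation_closed cls_closed An.l_distr An.r_distr An.m_assoc An.M.a_assoc flip: mult_cls)
next
  case (Mult_commute s t)
  then show ?case
    by (simp add: term_derivation_closed cls_closed An.m_comm An.M.a_comm)
next
  case (Mult_distrib s t u)
  then show ?case
    by (simp add: term_derivation_closed cls_closed An.l_distr An.r_distr An.M.a_ac flip: add_cls)
next
  case (Gen_mult x y i j)
  let ?f = "\<lambda>l. entry (d x) i l \<otimes>\<^bsub>An\<^esub> entry y l j" and ?g = "\<lambda>l. entry x i l \<otimes>\<^bsub>An\<^esub> entry (d y) l j"
  note closed = derivationsD(1)[OF d]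
  have "term_derivation d (foldr (\<lambda>l t. Add (Mult (Gen x i l) (Gen y l j)) t) ls (Const \<zero>\<^bsub>R\<^esub>)) =
      (\<Oplus>\<^bsub>An\<^esub>l\<in>set ls. ?f l \<oplus>\<^bsub>An\<^esub> ?g l)"
    if "set ls \<subseteq> {1..n}" "distinct ls" for ls
    using that
  proof (induction ls)
    case Nil
    then show ?case by simp
  next
    case (Cons l ls)
    with Gen_mult closed show ?case
      by (simp add: Pi_iff entry_closed subset_iff cls_Gen An.M.a_ac)
  qed
  from this[of "[1..<Suc n]"] have "term_derivation d (foldr (\<lambda>l t. Add (Mult (Gen x i l) (Gen y l j)) t)
      [1..<Suc n] (Const \<zero>\<^bsub>R\<^esub>)) = (\<Oplus>\<^bsub>An\<^esub>l\<in>{1..n}. ?f l \<oplus>\<^bsub>An\<^esub> ?g l)"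
    by (simp add: atLeastLessThanSuc_atLeastAtMost del: upt_Suc)
  also have "\<dots> = (\<Oplus>\<^bsub>An\<^esub>l\<in>{1..n}. ?f l) \<oplus>\<^bsub>An\<^esub> (\<Oplus>\<^bsub>An\<^esub>l\<in>{1..n}. ?g l)"
    using Gen_mult closed by (intro An.finsum_addf) (simp_all add: entry_closed)
  \<comment> \<open>By \<open>entry_mult\<close> the two sums are the entries of the two terms in
    the Leibniz rule for \<open>d\<close>.\<close>
  also have "\<dots> = entry (d (x \<otimes>\<^bsub>A\<^esub> y)) i j"
    using Gen_mult closed derivationsD(4)[OF d] by (simp add: entry_add entry_mult)
  finally show ?case by simp
qed (simp_all add: term_derivation_closed cls_closed derivationsD[OF d] derivation_one[OF ring_axioms d]
    entry_closed entry_zero entry_smult entry_add An.M.a_ac An.M.r_neg cls_Const cls_Gen An.smult_assoc2 flip: one_cls)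

lemma ex_derivation_rep_algebra:
  "\<exists>D\<in>derivations R An. \<forall>x\<in>carrier A. \<forall>i\<in>{1..n}. \<forall>j\<in>{1..n}. D (entry x i j) = entry (d x) i j"
proof
  \<comment> \<open>By \<open>term_derivation_cong\<close> the image of a class is a singleton, so
    \<open>the_elem\<close> returns its only value.\<close>
  define D where "D C = the_elem (term_derivation d ` C)" for C
  have D: "D (cls s) = term_derivation d s" if "s \<in> T" for s
  proof -
    have "(\<And>u. u \<in> cls s \<Longrightarrow> term_derivation d u = term_derivation d s)"
      using term_derivation_cong unfolding cls_def by fastforce
    moreover have "s \<in> cls s"
      using that by (simp add: cls_def rep_eq.Refl)
    ultimately have "term_derivation d ` cls s = {term_derivation d s}" by blast
    then show ?thesis by (simp add: D_def)
  qed
  show "D \<in> derivations R An"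
  proof (rule derivationsI)
    show "D x \<in> carrier An" if "x \<in> carrier An" for x
      using that by (auto elim!: carrier_cases simp: D term_derivation_closed)
    fix x y assume "x \<in> carrier An" "y \<in> carrier An"
    then obtain s t where st: "s \<in> T" "x = cls s" "t \<in> T" "y = cls t"
      by (metis carrier_cases)
    then show "D (x \<oplus>\<^bsub>An\<^esub> y) = D x \<oplus>\<^bsub>An\<^esub> D y"
      by (simp add: add_cls D rep_terms.Add)
    from st show "D (x \<otimes>\<^bsub>An\<^esub> y) = D x \<otimes>\<^bsub>An\<^esub> y \<oplus>\<^bsub>An\<^esub> x \<otimes>\<^bsub>An\<^esub> D y"
      by (simp add: mult_cls D rep_terms.Mult)
  next
    fix r x assume r: "r \<in> carrier R" and "x \<in> carrier An"
    then obtain s where s: "s \<in> T" "x = cls s" by (metis carrier_cases)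
    with r show "D (r \<odot>\<^bsub>An\<^esub> x) = r \<odot>\<^bsub>An\<^esub> D x"
      by (simp add: smult_cls D rep_terms.intros cls_Const cls_closed term_derivation_closed An.smult_assoc2)
  qed
  show "\<forall>x\<in>carrier A. \<forall>i\<in>{1..n}. \<forall>j\<in>{1..n}. D (entry x i j) = entry (d x) i j"
  proof (intro ballI)
    fix x i j assume "x \<in> carrier A" "i \<in> {1..n}" "j \<in> {1..n}"
    then show "D (entry x i j) = entry (d x) i j"
      using D[OF rep_terms.Gen] by (metis cls_Gen term_derivation.simps(2))
  qed
qed

end

section \<open>The trace on A\<close>

abbreviation "tr \<equiv> rep_trace R A n"

lemma trace_closed: "x \<in> carrier A \<Longrightarrow> tr x \<in> carrier An"
  by (simp add: rep_trace_def entry_closed)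

lemma trace_add:
  assumes "x \<in> carrier A" "y \<in> carrier A"
  shows "tr (x \<oplus>\<^bsub>A\<^esub> y) = tr x \<oplus>\<^bsub>An\<^esub> tr y"
proof -
  have "tr (x \<oplus>\<^bsub>A\<^esub> y) = (\<Oplus>\<^bsub>An\<^esub>i\<in>{1..n}. entry x i i \<oplus>\<^bsub>An\<^esub> entry y i i)"
    unfolding rep_trace_def
    using assms by (intro An.finsum_cong') (auto simp: entry_add entry_closed)
  also have "\<dots> = tr x \<oplus>\<^bsub>An\<^esub> tr y"
    unfolding rep_trace_def
    using assms by (intro An.finsum_addf) (auto simp: entry_closed)
  finally show ?thesis .
qed

lemma trace_smult:
  assumes "r \<in> carrier R" "x \<in> carrier A"
  shows "tr (r \<odot>\<^bsub>A\<^esub> x) = r \<odot>\<^bsub>An\<^esub> tr x"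
proof -
  have "tr (r \<odot>\<^bsub>A\<^esub> x) = (\<Oplus>\<^bsub>An\<^esub>i\<in>{1..n}. r \<odot>\<^bsub>An\<^esub> entry x i i)"
    unfolding rep_trace_def
    using assms by (intro An.finsum_cong') (auto simp: entry_smult entry_closed)
  also have "\<dots> = r \<odot>\<^bsub>An\<^esub> tr x"
    unfolding rep_trace_def
    using assms by (intro An.finsum_smult_ldistr[symmetric]) (auto simp: entry_closed)
  finally show ?thesis .
qed

lemma trace_zero: "tr \<zero>\<^bsub>A\<^esub> = \<zero>\<^bsub>An\<^esub>"
  using trace_smult[of "\<zero>\<^bsub>R\<^esub>" "\<zero>\<^bsub>A\<^esub>"] by (simp add: trace_closed)

lemma trace_uminus:
  assumes "x \<in> carrier A" shows "tr (\<ominus>\<^bsub>A\<^esub> x) = \<ominus>\<^bsub>An\<^esub> tr x"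
proof -
  have "\<ominus>\<^bsub>A\<^esub> x = (\<ominus>\<^bsub>R\<^esub> \<one>\<^bsub>R\<^esub>) \<odot>\<^bsub>A\<^esub> x"
    using assms by (simp add: smult_l_minus)
  then show ?thesis
    using assms by (simp add: trace_smult trace_closed An.smult_l_minus)
qed

text \<open>Both traces are double sums of the products \<open>entry x i l\<close> times
  \<open>entry y l i\<close>; they differ only in the order of summation and of the commuting
  factors.\<close>

lemma trace_mult_commute:
  assumes "x \<in> carrier A" "y \<in> carrier A"
  shows "tr (x \<otimes>\<^bsub>A\<^esub> y) = tr (y \<otimes>\<^bsub>A\<^esub> x)"
proof -
  have "tr (x \<otimes>\<^bsub>A\<^esub> y) = (\<Oplus>\<^bsub>An\<^esub>i\<in>{1..n}. \<Oplus>\<^bsub>An\<^esub>l\<in>{1..n}. entry x i l \<otimes>\<^bsub>An\<^esub> entry y l i)"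
    unfolding rep_trace_def
    using assms by (intro An.finsum_cong') (auto simp: entry_mult entry_closed)
  also have "\<dots> = (\<Oplus>\<^bsub>An\<^esub>l\<in>{1..n}. \<Oplus>\<^bsub>An\<^esub>i\<in>{1..n}. entry x i l \<otimes>\<^bsub>An\<^esub> entry y l i)"
    using assms by (intro An.finsum_swap) (auto simp: entry_closed)
  also have "\<dots> = tr (y \<otimes>\<^bsub>A\<^esub> x)"
    unfolding rep_trace_def
    using assms
    by (intro An.finsum_cong') (auto simp: entry_mult entry_closed An.m_comm intro!: An.finsum_cong' del: equalityI)
  finally show ?thesis .
qed

section \<open>The quotient A/A' and its trace\<close>

abbreviation "A' \<equiv> commutator_submodule R A"

text \<open>The kernel of the trace is a submodule containing all commutators, so it contains their
  hull.\<close>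

lemma commutator_submodule_trace: "x \<in> A' \<Longrightarrow> x \<in> carrier A \<and> tr x = \<zero>\<^bsub>An\<^esub>"
proof -
  have "A' \<subseteq> {x \<in> carrier A. tr x = \<zero>\<^bsub>An\<^esub>}"
    unfolding commutator_submodule_def
  proof (rule hull_minimal)
    show "submodule {x \<in> carrier A. tr x = \<zero>\<^bsub>An\<^esub>} R A"
      by (rule submoduleI) (auto simp: trace_add trace_smult trace_zero trace_uminus)
  qed (auto simp: minus_eq trace_add trace_uminus trace_closed An.M.r_neg trace_mult_commute)
  then show "x \<in> A' \<Longrightarrow> x \<in> carrier A \<and> tr x = \<zero>\<^bsub>An\<^esub>" by blast
qed

lemma commutator_submodule: "submodule A' R A"
proof -
  let ?S = "{x \<otimes>\<^bsub>A\<^esub> y \<ominus>\<^bsub>A\<^esub> y \<otimes>\<^bsub>A\<^esub> x | x y. x \<in> carrier A \<and> y \<in> carrier A}"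
  have A': "x \<in> A' \<longleftrightarrow> (\<forall>H. submodule H R A \<and> ?S \<subseteq> H \<longrightarrow> x \<in> H)" for x
    unfolding commutator_submodule_def hull_def by blast
  show ?thesis
  proof (rule submoduleI)
    \<comment> \<open>This needs some submodule containing the commutators; the kernel of the trace
      has already served as one.\<close>
    show "A' \<subseteq> carrier A"
      using commutator_submodule_trace by blast
    show "\<zero>\<^bsub>A\<^esub> \<in> A'"
      unfolding A' using subgroup.one_closed[OF submodule.axioms(1)] by fastforce
    show "\<ominus>\<^bsub>A\<^esub> a \<in> A'" if "a \<in> A'" for a
      using that unfolding A' by (blast intro: submoduleE(3))
    show "a \<oplus>\<^bsub>A\<^esub> b \<in> A'" if "a \<in> A'" "b \<in> A'" for a b
      using that unfolding A' by (blast intro: submoduleE(5))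
    show "r \<odot>\<^bsub>A\<^esub> a \<in> A'" if "r \<in> carrier R" "a \<in> A'" for r a
      using that unfolding A' by (blast intro: submoduleE(4))
  qed
qed

abbreviation "check_A \<equiv> check_module R A"
abbreviation "ctr \<equiv> check_trace R A n"

lemma carrier_check: "carrier check_A = (\<lambda>x. A' +>\<^bsub>A\<^esub> x) ` carrier A"
  by (auto simp: check_module_def Let_def A_RCOSETS_def' a_r_coset_def')

text \<open>The trace is constant on the coset because it vanishes on \<open>A'\<close>; as
  \<open>A'\<close> is nonempty, the image is a singleton and not empty.\<close>

lemma check_trace_coset:
  assumes x: "x \<in> carrier A" shows "ctr (A' +>\<^bsub>A\<^esub> x) = tr x"
proof -
  have "A' \<noteq> {}"
    using submoduleE(2)[OF commutator_submodule] .
  moreover have "tr (a \<oplus>\<^bsub>A\<^esub> x) = tr x" if "a \<in> A'" for a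
    using commutator_submodule_trace[OF that] x by (simp add: trace_add trace_closed)
  ultimately have "tr ` (A' +>\<^bsub>A\<^esub> x) = {tr x}"
    by (auto simp: a_r_coset_def' image_iff)
  then show ?thesis by (simp add: check_trace_def)
qed

lemma check_trace_uminus:
  assumes C: "C \<in> carrier check_A" shows "ctr (\<ominus>\<^bsub>check_A\<^esub> C) = \<ominus>\<^bsub>An\<^esub> ctr C"
proof -
  interpret A': abelian_subgroup A' A
    by (rule abelian_subgroupI2[OF M.a_comm_group submodule.axioms(1)[OF commutator_submodule]])
  obtain x where x: "x \<in> carrier A" "C = A' +>\<^bsub>A\<^esub> x"
    using C by (auto simp: carrier_check)
  \<comment> \<open>The additive structure of \<open>check_A\<close> is that of the factor group, so
    the negative can be computed there.\<close>
  have "\<ominus>\<^bsub>check_A\<^esub> C = inv\<^bsub>A A_Mod A'\<^esub> C"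
    by (simp add: a_inv_def m_inv_def check_module_def Let_def A_FactGroup_def FactGroup_def
        A_RCOSETS_def set_add_def)
  also have "\<dots> = A' +>\<^bsub>A\<^esub> (\<ominus>\<^bsub>A\<^esub> x)"
  proof -
    have "C \<in> carrier (A A_Mod A')"
      using C by (simp add: A_FactGroup_def FactGroup_def check_module_def Let_def A_RCOSETS_def)
    then show ?thesis
      using x by (simp add: A'.a_inv_FactGroup A'.a_rcos_inv)
  qed
  finally show ?thesis
    using x by (simp add: check_trace_coset trace_uminus)
qed

end

section \<open>The trace algebra\<close>

context algebra
begin

lemma subalgebra_hull:
  assumes S: "S \<subseteq> carrier M"
  defines "H \<equiv> (\<lambda>S. subring S M \<and> submodule S R M) hull S"
  shows "subring H M" and "submodule H R M"
proof -
  have HI: "x \<in> H" if "\<And>K. \<lbrakk>subring K M; submodule K R M; S \<subseteq> K\<rbrakk> \<Longrightarrow> x \<in> K" for x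
    using that by (simp add: H_def hull_def)
  have HD: "x \<in> K" if "x \<in> H" "subring K M" "submodule K R M" "S \<subseteq> K" for x K
    using that by (simp add: H_def hull_def)
  \<comment> \<open>The whole algebra is one of the subalgebras intersected in
    \<open>H\<close>.\<close>
  have sub: "H \<subseteq> carrier M"
    using HD[OF _ carrier_is_subring carrier_is_submodule S] by (rule subsetI)
  show "subring H M"
  proof (rule subringI[OF sub])
    show "\<one>\<^bsub>M\<^esub> \<in> H"
      by (rule HI) (rule subringE(3))
    show "\<ominus>\<^bsub>M\<^esub> a \<in> H" if "a \<in> H" for a
      by (rule HI) (rule subringE(5), assumption, rule HD[OF that])
    show "a \<otimes>\<^bsub>M\<^esub> b \<in> H" if "a \<in> H" "b \<in> H" for a b
      by (rule HI) (rule subringE(6), assumption, rule HD[OF that(1)], assumption+, rule HD[OF that(2)])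
    show "a \<oplus>\<^bsub>M\<^esub> b \<in> H" if "a \<in> H" "b \<in> H" for a b
      by (rule HI) (rule subringE(7), assumption, rule HD[OF that(1)], assumption+, rule HD[OF that(2)])
  qed
  note ring = subringE[OF this]
  show "submodule H R M"
  proof (rule submoduleI[OF sub ring(2) ring(5) ring(7)])
    show "r \<odot>\<^bsub>M\<^esub> a \<in> H" if "r \<in> carrier R" "a \<in> H" for r a
      by (rule HI) (rule submoduleE(4), assumption, rule that(1), rule HD[OF that(2)])
  qed
qed

lemma algebra_subalgebra:
  assumes "subring H M" "submodule H R M"
  shows "algebra R (M\<lparr>carrier := H\<rparr>)"
proof (intro algebra.intro algebra_axioms.intro)
  show "module R (M\<lparr>carrier := H\<rparr>)"
    by (rule submodule.submodule_is_module[OF assms(2) module])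
  show "cring (M\<lparr>carrier := H\<rparr>)"
    using subcring_iff[OF subringE(1)[OF assms(1)]] subcringI'[OF assms(1)] by simp
qed (use subringE(1)[OF assms(1)] in \<open>simp add: smult_assoc2 subset_iff\<close>)

lemma generated_algebra_hull:
  assumes t: "t ` X \<subseteq> carrier M"
  defines "H \<equiv> (\<lambda>S. subring S M \<and> submodule S R M) hull (t ` X)"
  shows "generated_algebra R (M\<lparr>carrier := H\<rparr>) X t"
proof -
  note sub = subalgebra_hull[OF t, folded H_def]
  note ring = subringE[OF sub(1)] and smult = submoduleE(4)[OF sub(2)]
  show ?thesis
  proof (rule generated_algebra.intro[OF algebra_subalgebra[OF sub] generated_algebra_axioms.intro])
    show "t x \<in> carrier (M\<lparr>carrier := H\<rparr>)" if "x \<in> X" for x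
      using hull_subset[of "t ` X"] that by (auto simp: H_def)
    fix P b
    assume b: "b \<in> carrier (M\<lparr>carrier := H\<rparr>)"
      and gen: "\<And>x. x \<in> X \<Longrightarrow> P (t x)"
      and one: "P \<one>\<^bsub>M\<lparr>carrier := H\<rparr>\<^esub>"
      and add: "\<And>a b. \<lbrakk>a \<in> carrier (M\<lparr>carrier := H\<rparr>); b \<in> carrier (M\<lparr>carrier := H\<rparr>); P a; P b\<rbrakk> \<Longrightarrow>
        P (a \<oplus>\<^bsub>M\<lparr>carrier := H\<rparr>\<^esub> b)"
      and mult: "\<And>a b. \<lbrakk>a \<in> carrier (M\<lparr>carrier := H\<rparr>); b \<in> carrier (M\<lparr>carrier := H\<rparr>); P a; P b\<rbrakk> \<Longrightarrow>
        P (a \<otimes>\<^bsub>M\<lparr>carrier := H\<rparr>\<^esub> b)"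
      and smul: "\<And>r a. \<lbrakk>r \<in> carrier R; a \<in> carrier (M\<lparr>carrier := H\<rparr>); P a\<rbrakk> \<Longrightarrow>
        P (r \<odot>\<^bsub>M\<lparr>carrier := H\<rparr>\<^esub> a)"
    \<comment> \<open>\<open>?K\<close> turns out to be a subalgebra containing the generators, so
      minimality of the hull gives \<open>H \<subseteq> ?K\<close>.\<close>
    let ?K = "{b \<in> H. P b}"
    have add': "a \<oplus>\<^bsub>M\<^esub> b \<in> ?K" if "a \<in> ?K" "b \<in> ?K" for a b
      using add[of a b] ring(7)[of a b] that by simp
    have mult': "a \<otimes>\<^bsub>M\<^esub> b \<in> ?K" if "a \<in> ?K" "b \<in> ?K" for a b
      using mult[of a b] ring(6)[of a b] that by simp
    have smul': "r \<odot>\<^bsub>M\<^esub> a \<in> ?K" if "r \<in> carrier R" "a \<in> ?K" for r a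
      using smul[of r a] smult[of r a] that by simp
    have one': "\<one>\<^bsub>M\<^esub> \<in> ?K"
      using one ring(3) by simp
    \<comment> \<open>The induction principle has no cases for zero and negatives; they are obtained
      as multiples by 0 and -1.\<close>
    have zero': "\<zero>\<^bsub>M\<^esub> \<in> ?K"
      using smul'[OF R.zero_closed one'] by simp
    have uminus': "\<ominus>\<^bsub>M\<^esub> a \<in> ?K" if "a \<in> ?K" for a
    proof -
      have "a \<in> carrier M"
        using that ring(1) by blast
      then have "(\<ominus>\<^bsub>R\<^esub> \<one>\<^bsub>R\<^esub>) \<odot>\<^bsub>M\<^esub> a = \<ominus>\<^bsub>M\<^esub> a"
        by (simp add: smult_l_minus)
      with smul'[of "\<ominus>\<^bsub>R\<^esub> \<one>\<^bsub>R\<^esub>" a] that show ?thesis by simp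
    qed
    have subset: "?K \<subseteq> carrier M"
      using ring(1) by blast
    have "subring ?K M"
      by (rule subringI) (fact subset one' uminus' mult' add')+
    moreover have "submodule ?K R M"
      by (rule submoduleI) (fact subset zero' uminus' add' smul')+
    moreover have "t ` X \<subseteq> ?K"
      using gen hull_subset[of "t ` X"] by (auto simp: H_def)
    ultimately have "H \<subseteq> ?K"
      unfolding H_def by (intro hull_minimal) simp_all
    with b show "P b" by auto
  qed
qed

end

section \<open>The trace algebra as an algebra generated by traces\<close>

context representation_algebra
begin

abbreviation "Tn \<equiv> trace_algebra R A n"

lemma image_check_trace: "ctr ` carrier check_A = tr ` carrier A"
  by (auto simp: carrier_check check_trace_coset image_image)

text \<open>The generators are indexed by cosets rather than by elements of \<open>A\<close>, to
  match the arguments of a brace.\<close>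

sublocale Tn: generated_algebra R Tn "carrier check_A" ctr
  unfolding trace_algebra_def image_check_trace[symmetric]
  by (rule An.generated_algebra_hull) (auto simp: image_check_trace trace_closed)

lemma trace_algebra_simps:
  "x \<oplus>\<^bsub>Tn\<^esub> y = x \<oplus>\<^bsub>An\<^esub> y" "x \<otimes>\<^bsub>Tn\<^esub> y = x \<otimes>\<^bsub>An\<^esub> y" "r \<odot>\<^bsub>Tn\<^esub> x = r \<odot>\<^bsub>An\<^esub> x"
  "\<one>\<^bsub>Tn\<^esub> = \<one>\<^bsub>An\<^esub>" "\<zero>\<^bsub>Tn\<^esub> = \<zero>\<^bsub>An\<^esub>"
  by (simp_all add: trace_algebra_def)

lemma carrier_trace_algebra: "x \<in> carrier Tn \<Longrightarrow> x \<in> carrier An"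
  using An.subalgebra_hull(1)[of "tr ` carrier A"] subringE(1) trace_closed
  by (force simp: trace_algebra_def)

text \<open>Unlike the operations above, the negative is defined through the carrier, so changing
  the carrier could change it. Both negatives equal the multiple by -1, which is the same in the two
  algebras.\<close>

lemma uminus_trace_algebra: "x \<in> carrier Tn \<Longrightarrow> \<ominus>\<^bsub>Tn\<^esub> x = \<ominus>\<^bsub>An\<^esub> x"
  using carrier_trace_algebra Tn.smult_l_minus[of "\<one>\<^bsub>R\<^esub>" x] An.smult_l_minus[of "\<one>\<^bsub>R\<^esub>" x]
  by (auto simp: trace_algebra_simps)

text \<open>The derivation \<open>D\<close> of A_n induced by \<open>d\<close> sends
  \<open>tr x\<close> to \<open>tr (d x)\<close>. It therefore maps generators of the trace algebra
  into it, and by the Leibniz rule the whole subalgebra, so it restricts.\<close>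

lemma extends_trace_derivation:
  assumes d: "d \<in> derivations R A"
    and f: "\<And>x. x \<in> carrier A \<Longrightarrow> f (A' +>\<^bsub>A\<^esub> x) = A' +>\<^bsub>A\<^esub> d x"
  shows "Tn.extends (\<lambda>C. ctr (f C))"
proof -
  obtain D where D: "D \<in> derivations R An"
    and entry: "\<And>x i j. \<lbrakk>x \<in> carrier A; i \<in> {1..n}; j \<in> {1..n}\<rbrakk> \<Longrightarrow> D (entry x i j) = entry (d x) i j"
    using ex_derivation_rep_algebra[OF d] by blast
  have D_tr: "D (tr x) = tr (d x)" if x: "x \<in> carrier A" for x
  proof -
    have "D (tr x) = (\<Oplus>\<^bsub>An\<^esub>i\<in>{1..n}. D (entry x i i))"
      unfolding rep_trace_def
      using x by (intro derivation_finsum[OF An.ring_axioms D]) (auto simp: entry_closed)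
    also have "\<dots> = tr (d x)"
      unfolding rep_trace_def
      using x derivationsD(1)[OF d] by (intro An.finsum_cong') (auto simp: entry entry_closed)
    finally show ?thesis .
  qed
  then have D_ctr: "D (ctr C) = ctr (f C)" "f C \<in> carrier check_A" if "C \<in> carrier check_A" for C
    using that derivationsD(1)[OF d] by (auto simp: carrier_check check_trace_coset f)
  have closed: "D b \<in> carrier Tn" if "b \<in> carrier Tn" for b
    using that
  proof (induction rule: Tn.generated_induct)
    case one
    then show ?case
      using derivation_one[OF An.ring_axioms D] Tn.M.zero_closed by (simp add: trace_algebra_simps)
  next
    case (add a b)
    then show ?case
      using derivationsD(2)[OF D, of a b] Tn.M.a_closed[of "D a" "D b"]
      by (simp add: trace_algebra_simps carrier_trace_algebra)
  next
    case (mult a b)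
    then show ?case
      using derivationsD(4)[OF D, of a b]
        Tn.M.a_closed[OF Tn.m_closed[of "D a" b] Tn.m_closed[of a "D b"]]
      by (simp add: trace_algebra_simps carrier_trace_algebra)
  next
    case (smult r a)
    then show ?case
      using derivationsD(3)[OF D, of r a] Tn.smult_closed[of r "D a"]
      by (simp add: trace_algebra_simps carrier_trace_algebra)
  qed (simp add: D_ctr Tn.t_closed)
  have "D \<in> derivations R Tn"
    using closed derivationsD[OF D]
    by (intro derivationsI) (simp_all add: trace_algebra_simps carrier_trace_algebra)
  with D_ctr(1) show ?thesis
    unfolding Tn.extends_def by blast
qed

end

section \<open>The induced brace: existence, uniqueness and symmetry\<close>

theorem lemma3p1:
  fixes R :: "('r, 'p) ring_scheme" and A :: "('r, 'a, 'q) module_scheme"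
    and m n :: nat and \<mu> :: "'a set list \<Rightarrow> 'a set"
  assumes "cring R" and "assoc_algebra R A" and "m \<ge> 1" and "n \<ge> 1"
    and "\<mu> \<in> braces R A m"
  shows "\<exists>\<mu>\<^sub>n.
    (\<mu>\<^sub>n \<in> comm_braces R (trace_algebra R A n) m \<and>
     (\<forall>xs\<in>tuples (check_module R A) m.
        \<mu>\<^sub>n (map (check_trace R A n) xs) = check_trace R A n (\<mu> xs))) \<and>
    (\<forall>\<nu>.
       \<nu> \<in> comm_braces R (trace_algebra R A n) m \<and>
       (\<forall>xs\<in>tuples (check_module R A) m.
          \<nu> (map (check_trace R A n) xs) = check_trace R A n (\<mu> xs)) \<longrightarrow> \<nu> = \<mu>\<^sub>n) \<and>
    (cyclically_symmetric (check_module R A) m \<mu> \<longrightarrow>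
       cyclically_symmetric (trace_algebra R A n) m \<mu>\<^sub>n) \<and>
    (m = 2 \<and> skew_symmetric (check_module R A) \<mu> \<longrightarrow>
       skew_symmetric (trace_algebra R A n) \<mu>\<^sub>n)"
proof -
  interpret representation_algebra R A n
    using assms(2) by (rule representation_algebra.intro)
  have \<mu>_closed: "\<mu> xs \<in> carrier check_A" if "xs \<in> tuples check_A m" for xs
    using assms(5) that by (auto simp: braces_def brackets_def)
  have "Tn.extends (\<lambda>C. ctr (\<mu> (xs[i := C])))"
    if xs: "set xs \<subseteq> carrier check_A" "length xs = m" "i < m" for xs i
  proof -
    have "(\<lambda>C. \<mu> (xs[i := C])) \<in> weak_derivations R A"
      using assms(5) xs by (simp add: braces_def tuples_def)
    then show ?thesis
      using extends_trace_derivation by (auto simp: weak_derivations_def)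
  qed
  from Tn.ex_comm_brace_extension[of m "\<lambda>xs. ctr (\<mu> xs)", OF this \<open>m \<ge> 1\<close>]
  obtain \<mu>n where \<mu>n: "\<mu>n \<in> comm_braces R Tn m"
    and \<mu>n_tr: "\<And>xs. xs \<in> tuples check_A m \<Longrightarrow> \<mu>n (map ctr xs) = ctr (\<mu> xs)"
    by (auto simp: tuples_def)
  show ?thesis
  proof (intro exI[of _ \<mu>n] conjI allI impI ballI)
    show "\<mu>n \<in> comm_braces R Tn m" by fact
    show "\<mu>n (map ctr xs) = ctr (\<mu> xs)" if "xs \<in> tuples check_A m" for xs
      using that by (rule \<mu>n_tr)
  next
    fix \<nu>
    assume "\<nu> \<in> comm_braces R Tn m \<and> (\<forall>xs\<in>tuples check_A m. \<nu> (map ctr xs) = ctr (\<mu> xs))"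
    then have \<nu>: "\<nu> \<in> comm_braces R Tn m"
      and \<nu>_tr: "\<And>xs. xs \<in> tuples check_A m \<Longrightarrow> \<nu> (map ctr xs) = ctr (\<mu> xs)"
      by auto
    have "\<nu> bs = \<mu>n bs" if "bs \<in> tuples Tn m" for bs
    proof (rule Tn.multiderivation_eqI[where \<nu> = \<nu> and \<nu>' = \<mu>n,
          OF Tn.comm_braces_derivation[OF \<nu>] Tn.comm_braces_derivation[OF \<mu>n] _ that])
      fix xs assume "set xs \<subseteq> carrier check_A" "length xs = m"
      then have "xs \<in> tuples check_A m" by (simp add: tuples_def)
      then show "\<nu> (map ctr xs) = \<mu>n (map ctr xs)" by (simp add: \<nu>_tr \<mu>n_tr)
    qed
    \<comment> \<open>Both maps are \<open>undefined\<close> outside the tuples, so agreement on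
      tuples gives equality.\<close>
    then show "\<nu> = \<mu>n"
      using \<nu> \<mu>n
      by (intro PiE_ext[of \<nu> "tuples Tn m" "\<lambda>_. carrier Tn"]) (auto simp: comm_braces_def brackets_def)
  next
    assume "cyclically_symmetric check_A m \<mu>"
    then show "cyclically_symmetric Tn m \<mu>n"
      using \<open>m \<ge> 1\<close> \<mu>n_tr
      by (intro Tn.cyclically_symmetricI[OF \<mu>n])
        (auto simp: cyclically_symmetric_def tuples_def simp flip: map_append list.map)
  next
    assume "m = 2 \<and> skew_symmetric check_A \<mu>"
    then have [simp]: "m = 2" and skew: "skew_symmetric check_A \<mu>" by auto
    have tr2: "\<mu>n [ctr x, ctr y] = ctr (\<mu> [x, y])" "ctr (\<mu> [x, y]) \<in> carrier Tn"
      if "x \<in> carrier check_A" "y \<in> carrier check_A" for x y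
      using \<mu>n_tr[of "[x, y]"] \<mu>_closed[of "[x, y]"] that by (simp_all add: tuples_def Tn.t_closed)
    show "skew_symmetric Tn \<mu>n"
    proof (rule Tn.skew_symmetricI)
      show "\<mu>n \<in> comm_braces R Tn 2" using \<mu>n by simp
      fix x y assume xy: "x \<in> carrier check_A" "y \<in> carrier check_A"
      then have "\<mu> [x, y] = \<ominus>\<^bsub>check_A\<^esub> \<mu> [y, x]"
        using skew unfolding skew_symmetric_def by blast
      with xy have "\<mu>n [ctr x, ctr y] = ctr (\<ominus>\<^bsub>check_A\<^esub> \<mu> [y, x])"
        by (simp add: tr2)
      \<comment> \<open>The negative passes from A/A' to A_n through the trace, and from there to
        the subalgebra.\<close>
      also have "\<dots> = \<ominus>\<^bsub>Tn\<^esub> ctr (\<mu> [y, x])"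
        using xy \<mu>_closed[of "[y, x]"] tr2(2)[of y x]
        by (simp add: check_trace_uminus uminus_trace_algebra tuples_def)
      finally show "\<mu>n [ctr x, ctr y] = \<ominus>\<^bsub>Tn\<^esub> \<mu>n [ctr y, ctr x]"
        using xy by (simp add: tr2)
    qed
  qed
qed

end
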